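(* Let $m,p,n\ge 1$ be integers with $p\mid m$. The Artin basis $\mathcal{A}(m, p, n)$ descends to a $K$-basis for the coinvariant algebra $\mathcal{R}_{G(m, p, n)} = K[x_1, \ldots, x_n]/\mathcal{I}_{G(m, p, n)}$; that is, the images of the monomials in $\mathcal{A}(m,p,n)$ form a basis of $\mathcal{R}_{G(m,p,n)}$.
   Context: $K \subset \mathbb{C}$ is a subfield closed under complex conjugation containing the $m$th roots of unity. $G(m,p,n)$ is the group of $n\times n$ matrices over $K$ with exactly one non-zero entry in each row and column, each such entry an $m$th root of unity, such that the product of the non-zero entries raised to the power $m/p$ is $1$. It acts on $K[x_1,\dots,x_n]$, where $x_1,\dots,x_n$ are the coordinate functions on $K^n$, by $(\sigma\cdot f)(v)=f(\sigma^{-1}v)$. $\mathcal{I}_{G}$ is the ideal of $K[x_1,\dots,x_n]$ generated by all homogeneous $G$-invariant polynomials of positive degree. The Artin basis is the set of monomials $$\mathcal{A}(m, p, n) = \{x_1^{a_1} \cdots x_n^{a_n} : \exists j \in \{1,\dots,n\} \text{ such that } 0 \leq a_i < im\ \forall i < j;\ 0 \leq a_j < \tfrac{m}{p};\ 0 \leq a_i - \tfrac{m}{p} < (i-1)m\ \forall i > j\},$$ where the $a_i$ are integers. *)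

theory Defs
  imports
    "HOL-Library.Poly_Mapping"
    "HOL-Algebra.QuotRing"
    "HOL-Algebra.Subrings"
    "Jordan_Normal_Form.Matrix"
    "Jordan_Normal_Form.VS_Connect"
begin

section \<open>Polynomials in several variables\<close>

text \<open>
  Indices of variables, of coordinates of vectors and of rows and columns of matrices all start
  at \<open>0\<close>, as in the matrix library: the variable with index \<open>i\<close> is the coordinate function usually
  written \<open>x\<^sub>i\<^sub>+\<^sub>1\<close>. A monomial is identified with its exponent vector.
\<close>

type_synonym monom = "nat \<Rightarrow>\<^sub>0 nat"
type_synonym mpoly = "monom \<Rightarrow>\<^sub>0 complex"

definition monomial :: "monom \<Rightarrow> mpoly" where
  "monomial a = Poly_Mapping.single a 1"

definition mconst :: "complex \<Rightarrow> mpoly" where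
  "mconst c = Poly_Mapping.single 0 c"

definition mvar :: "nat \<Rightarrow> mpoly" where
  "mvar i = monomial (Poly_Mapping.single i 1)"

definition mpoly_carrier :: "complex set \<Rightarrow> nat \<Rightarrow> mpoly set" where
  "mpoly_carrier K n =
     {f. (\<forall>a. Poly_Mapping.lookup f a \<in> K) \<and>
         (\<forall>a \<in> Poly_Mapping.keys f. Poly_Mapping.keys a \<subseteq> {..<n})}"

definition mpoly_ring :: "complex set \<Rightarrow> nat \<Rightarrow> mpoly ring" where
  "mpoly_ring K n =
     \<lparr> carrier = mpoly_carrier K n, mult = (*), one = 1, zero = 0, add = (+) \<rparr>"

definition homogeneous :: "nat \<Rightarrow> mpoly \<Rightarrow> bool" where
  "homogeneous d f \<longleftrightarrow>
     (\<forall>a \<in> Poly_Mapping.keys f. (\<Sum>i \<in> Poly_Mapping.keys a. Poly_Mapping.lookup a i) = d)"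

definition msubst :: "(nat \<Rightarrow> mpoly) \<Rightarrow> mpoly \<Rightarrow> mpoly" where
  "msubst s f =
     (\<Sum>a \<in> Poly_Mapping.keys f. mconst (Poly_Mapping.lookup f a) *
        (\<Prod>i \<in> Poly_Mapping.keys a. s i ^ Poly_Mapping.lookup a i))"

definition meval :: "mpoly \<Rightarrow> complex vec \<Rightarrow> complex" where
  "meval f v =
     (\<Sum>a \<in> Poly_Mapping.keys f. Poly_Mapping.lookup f a *
        (\<Prod>i \<in> Poly_Mapping.keys a. (v $ i) ^ Poly_Mapping.lookup a i))"


section \<open>The groups \<open>G(m,p,n)\<close> and their invariants\<close>

definition Gmpn :: "complex set \<Rightarrow> nat \<Rightarrow> nat \<Rightarrow> nat \<Rightarrow> complex mat monoid" where
  "Gmpn K m p n =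
     \<lparr> carrier = {A \<in> carrier_mat n n.
          (\<forall>i<n. \<forall>j<n. A $$ (i, j) \<in> K) \<and>
          (\<forall>i<n. \<exists>!j. j < n \<and> A $$ (i, j) \<noteq> 0) \<and>
          (\<forall>j<n. \<exists>!i. i < n \<and> A $$ (i, j) \<noteq> 0) \<and>
          (\<forall>i<n. \<forall>j<n. A $$ (i, j) \<noteq> 0 \<longrightarrow> A $$ (i, j) ^ m = 1) \<and>
          (\<Prod>(i, j) \<in> {(i, j). i < n \<and> j < n \<and> A $$ (i, j) \<noteq> 0}. A $$ (i, j)) ^ (m div p) = 1},
       mult = (*), one = 1\<^sub>m n \<rparr>"

text \<open>
  Since \<open>x\<^sub>i(A\<^sup>-\<^sup>1 v) = (\<Sum>j. A\<^sup>-\<^sup>1\<^sub>i\<^sub>j x\<^sub>j(v))\<close>, the polynomial function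
  \<open>v \<mapsto> f (A\<^sup>-\<^sup>1 v)\<close> is obtained from \<open>f\<close> by a linear substitution;
  see lemma \<open>meval_Gmpn_act\<close> below.
\<close>

definition Gmpn_act :: "complex set \<Rightarrow> nat \<Rightarrow> nat \<Rightarrow> nat \<Rightarrow> complex mat \<Rightarrow> mpoly \<Rightarrow> mpoly" where
  "Gmpn_act K m p n A f =
     msubst (\<lambda>i. \<Sum>j<n. mconst ((inv\<^bsub>Gmpn K m p n\<^esub> A) $$ (i, j)) * mvar j) f"

definition Gmpn_invariant :: "complex set \<Rightarrow> nat \<Rightarrow> nat \<Rightarrow> nat \<Rightarrow> mpoly \<Rightarrow> bool" where
  "Gmpn_invariant K m p n f \<longleftrightarrow> (\<forall>A \<in> carrier (Gmpn K m p n). Gmpn_act K m p n A f = f)"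


section \<open>The coinvariant algebra\<close>

definition coinvariant_ideal :: "complex set \<Rightarrow> nat \<Rightarrow> nat \<Rightarrow> nat \<Rightarrow> mpoly set" where
  "coinvariant_ideal K m p n =
     Idl\<^bsub>mpoly_ring K n\<^esub> {f \<in> mpoly_carrier K n. Gmpn_invariant K m p n f \<and> (\<exists>d>0. homogeneous d f)}"

definition coinvariant_proj :: "complex set \<Rightarrow> nat \<Rightarrow> nat \<Rightarrow> nat \<Rightarrow> mpoly \<Rightarrow> mpoly set" where
  "coinvariant_proj K m p n f = coinvariant_ideal K m p n +>\<^bsub>mpoly_ring K n\<^esub> f"

abbreviation field_of :: "complex set \<Rightarrow> complex ring" where
  "field_of K \<equiv> class_ring \<lparr> carrier := K \<rparr>"

text \<open>The quotient ring, with a scalar \<open>c\<close> acting as multiplication by the class of \<open>c\<close>.\<close>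

definition coinvariant_algebra ::
    "complex set \<Rightarrow> nat \<Rightarrow> nat \<Rightarrow> nat \<Rightarrow> (complex, mpoly set) module" where
  "coinvariant_algebra K m p n =
     (let Q = mpoly_ring K n Quot coinvariant_ideal K m p n
      in \<lparr> carrier = carrier Q, mult = mult Q, one = one Q, zero = zero Q, add = add Q,
           smult = (\<lambda>c X. coinvariant_proj K m p n (mconst c) \<otimes>\<^bsub>Q\<^esub> X) \<rparr>)"


section \<open>The Artin basis\<close>

text \<open>
  Because indices start at \<open>0\<close>, the factors \<open>i\<close> and \<open>i - 1\<close> of the usual bounds
  \<open>0 \<le> a\<^sub>i < i m\<close> and \<open>0 \<le> a\<^sub>i - m/p < (i - 1) m\<close> become \<open>i + 1\<close> and \<open>i\<close>.
\<close>

definition artin_exponents :: "nat \<Rightarrow> nat \<Rightarrow> nat \<Rightarrow> monom set" where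
  "artin_exponents m p n =
     {a. Poly_Mapping.keys a \<subseteq> {..<n} \<and>
         (\<exists>j<n. (\<forall>i<j. Poly_Mapping.lookup a i < (i + 1) * m) \<and>
                Poly_Mapping.lookup a j < m div p \<and>
                (\<forall>i. j < i \<and> i < n \<longrightarrow>
                   0 \<le> int (Poly_Mapping.lookup a i) - int (m div p) \<and>
                   int (Poly_Mapping.lookup a i) - int (m div p) < int i * int m))}"

definition artin_basis :: "nat \<Rightarrow> nat \<Rightarrow> nat \<Rightarrow> mpoly set" where
  "artin_basis m p n = monomial ` artin_exponents m p n"


section \<open>Well-definedness\<close>

subsection \<open>The polynomial ring\<close>

lemma subfield_closed:
  assumes "subfield K (class_ring :: complex ring)"
  shows "0 \<in> K" "1 \<in> K" "x \<in> K \<Longrightarrow> y \<in> K \<Longrightarrow> x + y \<in> K"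
    "x \<in> K \<Longrightarrow> y \<in> K \<Longrightarrow> x * y \<in> K" "x \<in> K \<Longrightarrow> - x \<in> K"
proof -
  note sr = subringE[OF subfieldE(1)[OF assms]]
  show "0 \<in> K" "1 \<in> K" using sr(2,3) by simp_all
  show "x \<in> K \<Longrightarrow> y \<in> K \<Longrightarrow> x + y \<in> K" "x \<in> K \<Longrightarrow> y \<in> K \<Longrightarrow> x * y \<in> K"
    using sr(6,7)[of x y] by simp_all
  show "x \<in> K \<Longrightarrow> - x \<in> K" using sr(5)[of x] by (simp add: class_ring_simps)
qed

lemma sum_closed_in:
  assumes "subfield K (class_ring :: complex ring)" "\<And>x. x \<in> A \<Longrightarrow> f x \<in> K"
  shows "sum f A \<in> K"
  using assms(2) by (induction A rule: infinite_finite_induct) (auto simp: subfield_closed[OF assms(1)])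

lemma mpoly_carrier_mult:
  assumes K: "subfield K (class_ring :: complex ring)"
    and f: "f \<in> mpoly_carrier K n" and g: "g \<in> mpoly_carrier K n"
  shows "f * g \<in> mpoly_carrier K n"
proof -
  note cl = subfield_closed[OF K]
  have "Poly_Mapping.lookup (f * g) a \<in> K" for a
  proof -
    have "Poly_Mapping.lookup f b * (\<Sum>q. Poly_Mapping.lookup g q when a = b + q) \<in> K" for b
    proof -
      have "(\<Sum>q. Poly_Mapping.lookup g q when a = b + q) \<in> K"
        unfolding Sum_any.expand_set
        using g by (intro sum_closed_in[OF K]) (auto simp: mpoly_carrier_def when_def cl(1))
      then show ?thesis using f cl(4) by (auto simp: mpoly_carrier_def)
    qed
    then show ?thesis
      unfolding lookup_mult Sum_any.expand_set
      by (intro sum_closed_in[OF K])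
  qed
  moreover have "Poly_Mapping.keys a \<subseteq> {..<n}" if a: "a \<in> Poly_Mapping.keys (f * g)" for a
  proof -
    obtain b c where "a = b + c" "b \<in> Poly_Mapping.keys f" "c \<in> Poly_Mapping.keys g"
      using a Poly_Mapping.keys_mult[of f g] by fastforce
    then show ?thesis using f g Poly_Mapping.keys_add[of b c]
      by (fastforce simp: mpoly_carrier_def)
  qed
  ultimately show ?thesis by (auto simp: mpoly_carrier_def)
qed

lemma mconst_in_carrier: "c \<in> K \<Longrightarrow> 0 \<in> K \<Longrightarrow> mconst c \<in> mpoly_carrier K n"
  by (auto simp: mpoly_carrier_def mconst_def lookup_single when_def)

lemma mconst_simps:
  "mconst 0 = 0" "mconst 1 = 1" "mconst (a + b) = mconst a + mconst b"
  "mconst (a * b) = mconst a * mconst b"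
  by (simp_all add: mconst_def single_add mult_single)

lemma cring_mpoly_ring:
  assumes K: "subfield K (class_ring :: complex ring)"
  shows "cring (mpoly_ring K n)"
proof -
  note cl = subfield_closed[OF K]
  have add: "f + g \<in> mpoly_carrier K n" if "f \<in> mpoly_carrier K n" "g \<in> mpoly_carrier K n" for f g
    using that Poly_Mapping.keys_add[of f g]
    by (fastforce simp: mpoly_carrier_def lookup_add cl)
  have neg: "- f \<in> mpoly_carrier K n" if "f \<in> mpoly_carrier K n" for f
    using that by (auto simp: mpoly_carrier_def cl)
  have one: "1 \<in> mpoly_carrier K n" using mconst_in_carrier[OF cl(2,1)] by (simp add: mconst_simps)
  have zero: "0 \<in> mpoly_carrier K n" using mconst_in_carrier[OF cl(1,1)] by (simp add: mconst_simps)
  show ?thesis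
    unfolding mpoly_ring_def
  proof (intro cringI abelian_groupI comm_monoidI, simp_all add: add one zero mpoly_carrier_mult[OF K])
    show "\<exists>g \<in> mpoly_carrier K n. g + f = 0" if "f \<in> mpoly_carrier K n" for f
      using neg[OF that] by (intro bexI[of _ "- f"]) auto
  qed (simp_all add: algebra_simps)
qed

lemma ideal_coinvariant_ideal:
  assumes "subfield K (class_ring :: complex ring)"
  shows "ideal (coinvariant_ideal K m p n) (mpoly_ring K n)"
proof -
  interpret cring "mpoly_ring K n" by (rule cring_mpoly_ring[OF assms])
  show ?thesis unfolding coinvariant_ideal_def
    by (rule genideal_ideal) (auto simp: mpoly_ring_def)
qed

lemma vectorspace_coinvariant_algebra:
  assumes K: "subfield K (class_ring :: complex ring)"
  shows "vectorspace (field_of K) (coinvariant_algebra K m p n)"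
proof -
  note cl = subfield_closed[OF K]
  let ?P = "mpoly_ring K n" and ?I = "coinvariant_ideal K m p n"
  define Q where "Q = ?P Quot ?I"
  define h where "h c = coinvariant_proj K m p n (mconst c)" for c
  define V where "V = coinvariant_algebra K m p n"
  interpret P: cring ?P by (rule cring_mpoly_ring[OF K])
  interpret I: ideal ?I ?P by (rule ideal_coinvariant_ideal[OF K])
  interpret Q: cring Q unfolding Q_def by (rule I.quotient_is_cring[OF P.is_cring])
  interpret H: ring_hom_ring ?P Q "(+>\<^bsub>?P\<^esub>) ?I"
    unfolding Q_def by (rule I.rcos_ring_hom_ring)
  have mc: "c \<in> K \<Longrightarrow> mconst c \<in> carrier ?P" for c
    using mconst_in_carrier cl(1) by (simp add: mpoly_ring_def)
  have h: "c \<in> K \<Longrightarrow> h c \<in> carrier Q" for c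
    unfolding h_def coinvariant_proj_def by (rule H.hom_closed[OF mc])
  have hadd: "c \<in> K \<Longrightarrow> d \<in> K \<Longrightarrow> h (c + d) = h c \<oplus>\<^bsub>Q\<^esub> h d" for c d
    unfolding h_def coinvariant_proj_def H.hom_add[OF mc mc, symmetric]
    by (simp add: mpoly_ring_def mconst_simps)
  have hmult: "c \<in> K \<Longrightarrow> d \<in> K \<Longrightarrow> h (c * d) = h c \<otimes>\<^bsub>Q\<^esub> h d" for c d
    unfolding h_def coinvariant_proj_def H.hom_mult[OF mc mc, symmetric]
    by (simp add: mpoly_ring_def mconst_simps)
  have hone: "h 1 = \<one>\<^bsub>Q\<^esub>"
    using H.hom_one by (simp add: h_def coinvariant_proj_def mconst_simps mpoly_ring_def)
  have V: "carrier V = carrier Q" "add V = add Q" "zero V = zero Q"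
    "smult V = (\<lambda>c X. h c \<otimes>\<^bsub>Q\<^esub> X)"
    by (simp_all add: V_def coinvariant_algebra_def Q_def h_def fun_eq_iff Let_def)
  interpret K: field "field_of K"
    by (rule ring.subfield_iff(2)[OF field.is_ring[OF class_field] K])
  have "abelian_group V"
  proof (rule abelian_groupI)
    show "\<exists>Y \<in> carrier V. Y \<oplus>\<^bsub>V\<^esub> X = \<zero>\<^bsub>V\<^esub>" if "X \<in> carrier V" for X
      using that by (intro bexI[of _ "\<ominus>\<^bsub>Q\<^esub> X"]) (simp_all add: V Q.l_neg)
  qed (simp_all add: V Q.a_ac)
  then have "module (field_of K) V"
    by (intro moduleI K.is_cring)
      (simp_all add: V h hadd hmult hone Q.l_distr Q.r_distr Q.m_assoc)
  then show ?thesis unfolding V_def vectorspace_def using K.field_axioms by blast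
qed


subsection \<open>The group\<close>

definition monomial_mat :: "nat \<Rightarrow> (nat \<Rightarrow> nat) \<Rightarrow> (nat \<Rightarrow> complex) \<Rightarrow> complex mat" where
  "monomial_mat n \<pi> c = mat n n (\<lambda>(i, j). if j = \<pi> i then c i else 0)"

definition Gmpn_data :: "nat \<Rightarrow> nat \<Rightarrow> nat \<Rightarrow> (nat \<Rightarrow> nat) \<Rightarrow> (nat \<Rightarrow> complex) \<Rightarrow> bool" where
  "Gmpn_data m p n \<pi> c \<longleftrightarrow>
     \<pi> permutes {..<n} \<and> (\<forall>i<n. c i ^ m = 1) \<and> (\<Prod>i<n. c i) ^ (m div p) = 1"

lemma monomial_mat_in_Gmpn:
  assumes K: "subfield K (class_ring :: complex ring)"
    and root: "\<forall>z. z ^ m = 1 \<longrightarrow> z \<in> K" and m: "m \<ge> 1"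
    and d: "Gmpn_data m p n \<pi> c"
  shows "monomial_mat n \<pi> c \<in> carrier (Gmpn K m p n)"
proof -
  let ?A = "monomial_mat n \<pi> c"
  have perm: "\<pi> permutes {..<n}" and c: "i < n \<Longrightarrow> c i ^ m = 1" for i
    using d by (auto simp: Gmpn_data_def)
  have nz: "i < n \<Longrightarrow> c i \<noteq> 0" for i
    using c[of i] m by (cases "c i = 0") (auto simp: power_0_left)
  have entry: "i < n \<Longrightarrow> j < n \<Longrightarrow> ?A $$ (i, j) = (if j = \<pi> i then c i else 0)" for i j
    by (simp add: monomial_mat_def)
  have pi_lt: "i < n \<Longrightarrow> \<pi> i < n" for i
    using permutes_in_image[OF perm, of i] by simp
  have inv_lt: "i < n \<Longrightarrow> inv_into UNIV \<pi> i < n" for i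
    using permutes_in_image[OF permutes_inv[OF perm], of i] by simp
  have nonzero: "{(i, j). i < n \<and> j < n \<and> ?A $$ (i, j) \<noteq> 0} = (\<lambda>i. (i, \<pi> i)) ` {..<n}"
    using pi_lt nz by (auto simp: entry split: if_splits)
  have "(\<Prod>(i, j) \<in> {(i, j). i < n \<and> j < n \<and> ?A $$ (i, j) \<noteq> 0}. ?A $$ (i, j)) = (\<Prod>i<n. c i)"
    unfolding nonzero by (subst prod.reindex) (auto simp: inj_on_def entry pi_lt)
  moreover have "\<exists>!j. j < n \<and> ?A $$ (i, j) \<noteq> 0" if "i < n" for i
    using that pi_lt nz by (intro ex1I[of _ "\<pi> i"]) (auto simp: entry split: if_splits)
  moreover have "\<exists>!i. i < n \<and> ?A $$ (i, j) \<noteq> 0" if "j < n" for j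
    using that inv_lt[of j] nz[of "inv_into UNIV \<pi> j"] permutes_inverses[OF perm]
    by (intro ex1I[of _ "inv_into UNIV \<pi> j"]) (auto simp: entry split: if_splits)
  ultimately show ?thesis
    using d root subfield_closed(1)[OF K]
    by (auto simp: Gmpn_def Gmpn_data_def entry) (auto simp: monomial_mat_def)
qed

lemma Gmpn_obtain_data:
  assumes A: "A \<in> carrier (Gmpn K m p n)"
  obtains \<pi> c where "Gmpn_data m p n \<pi> c" "A = monomial_mat n \<pi> c"
proof -
  define \<pi> where "\<pi> i = (if i < n then THE j. j < n \<and> A $$ (i, j) \<noteq> 0 else i)" for i
  define c where "c i = A $$ (i, \<pi> i)" for i
  have A_carrier: "A \<in> carrier_mat n n"
    and row: "i < n \<Longrightarrow> \<exists>!j. j < n \<and> A $$ (i, j) \<noteq> 0"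
    and col: "j < n \<Longrightarrow> \<exists>!i. i < n \<and> A $$ (i, j) \<noteq> 0"
    and root: "i < n \<Longrightarrow> j < n \<Longrightarrow> A $$ (i, j) \<noteq> 0 \<Longrightarrow> A $$ (i, j) ^ m = 1"
    and prd: "(\<Prod>(i, j) \<in> {(i, j). i < n \<and> j < n \<and> A $$ (i, j) \<noteq> 0}. A $$ (i, j)) ^ (m div p) = 1"
    for i j using A by (auto simp: Gmpn_def)
  have pi: "i < n \<Longrightarrow> \<pi> i < n \<and> A $$ (i, \<pi> i) \<noteq> 0" for i
    using theI'[OF row[of i]] by (simp add: \<pi>_def)
  have pi_eq: "i < n \<Longrightarrow> j < n \<Longrightarrow> A $$ (i, j) \<noteq> 0 \<Longrightarrow> j = \<pi> i" for i j
    using row[of i] pi[of i] by blast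
  have inj: "inj_on \<pi> {..<n}"
  proof (rule inj_onI)
    fix i i' assume "i \<in> {..<n}" "i' \<in> {..<n}" "\<pi> i = \<pi> i'"
    then show "i = i'" using col[of "\<pi> i"] pi[of i] pi[of i'] by (metis lessThan_iff)
  qed
  have "\<pi> ` {..<n} \<subseteq> {..<n}" using pi by auto
  then have "bij_betw \<pi> {..<n} {..<n}"
    using inj by (simp add: bij_betw_def endo_inj_surj)
  then have perm: "\<pi> permutes {..<n}"
    by (rule bij_imp_permutes) (simp add: \<pi>_def)
  have nonzero: "{(i, j). i < n \<and> j < n \<and> A $$ (i, j) \<noteq> 0} = (\<lambda>i. (i, \<pi> i)) ` {..<n}"
    using pi pi_eq by auto
  have "(\<Prod>(i, j) \<in> {(i, j). i < n \<and> j < n \<and> A $$ (i, j) \<noteq> 0}. A $$ (i, j)) = (\<Prod>i<n. c i)"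
    unfolding nonzero by (subst prod.reindex) (auto simp: inj_on_def c_def)
  then have "Gmpn_data m p n \<pi> c"
    using perm root pi prd by (auto simp: Gmpn_data_def c_def)
  moreover have "A = monomial_mat n \<pi> c"
  proof (rule eq_matI)
    fix i j assume "i < dim_row (monomial_mat n \<pi> c)" "j < dim_col (monomial_mat n \<pi> c)"
    then have "i < n" "j < n" by (auto simp: monomial_mat_def)
    then show "A $$ (i, j) = monomial_mat n \<pi> c $$ (i, j)"
      using pi_eq[of i j] by (auto simp: monomial_mat_def c_def)
  qed (use A_carrier in \<open>auto simp: monomial_mat_def\<close>)
  ultimately show ?thesis by (rule that)
qed

lemma monomial_mat_mult:
  assumes \<pi>: "\<pi> permutes {..<n}"
  shows "monomial_mat n \<pi> c * monomial_mat n \<rho> d = monomial_mat n (\<rho> \<circ> \<pi>) (\<lambda>i. c i * d (\<pi> i))"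
    (is "?L = ?R")
proof (rule eq_matI)
  fix i k assume "i < dim_row ?R" "k < dim_col ?R"
  then have lt: "i < n" "k < n" by (auto simp: monomial_mat_def)
  have "\<pi> i < n" using permutes_in_image[OF \<pi>, of i] lt by simp
  have "?L $$ (i, k) = (\<Sum>j<n. (if j = \<pi> i then c i else 0) * (if k = \<rho> j then d j else 0))"
    using lt by (simp add: monomial_mat_def scalar_prod_def atLeast0LessThan)
  also have "\<dots> = (\<Sum>j<n. if j = \<pi> i then c i * (if k = \<rho> (\<pi> i) then d (\<pi> i) else 0) else 0)"
    by (intro sum.cong) auto
  also have "\<dots> = c i * (if k = \<rho> (\<pi> i) then d (\<pi> i) else 0)"
    using \<open>\<pi> i < n\<close> by (simp add: sum.delta)
  finally show "?L $$ (i, k) = ?R $$ (i, k)"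
    using lt by (simp add: monomial_mat_def)
qed (auto simp: monomial_mat_def)

lemma monomial_mat_one: "monomial_mat n id (\<lambda>_. 1) = 1\<^sub>m n"
  by (rule eq_matI) (auto simp: monomial_mat_def)

lemma group_Gmpn:
  assumes K: "subfield K (class_ring :: complex ring)"
    and root: "\<forall>z. z ^ m = 1 \<longrightarrow> z \<in> K" and m: "m \<ge> 1"
  shows "group (Gmpn K m p n)"
proof (rule groupI)
  let ?G = "Gmpn K m p n"
  note I = monomial_mat_in_Gmpn[OF K root m, of p n]
  have mult: "A \<otimes>\<^bsub>?G\<^esub> B = A * B" and one: "\<one>\<^bsub>?G\<^esub> = 1\<^sub>m n" for A B
    by (simp_all add: Gmpn_def)
  have cm: "A \<in> carrier ?G \<Longrightarrow> A \<in> carrier_mat n n" for A by (simp add: Gmpn_def)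
  have "Gmpn_data m p n id (\<lambda>_. 1)"
    by (simp add: Gmpn_data_def permutes_id)
  from I[OF this] show "\<one>\<^bsub>?G\<^esub> \<in> carrier ?G"
    by (simp add: one monomial_mat_one)
  show "A \<otimes>\<^bsub>?G\<^esub> B \<otimes>\<^bsub>?G\<^esub> C = A \<otimes>\<^bsub>?G\<^esub> (B \<otimes>\<^bsub>?G\<^esub> C)"
    if "A \<in> carrier ?G" "B \<in> carrier ?G" "C \<in> carrier ?G" for A B C
    unfolding mult using that cm by (intro assoc_mult_mat) auto
  show "\<one>\<^bsub>?G\<^esub> \<otimes>\<^bsub>?G\<^esub> A = A" if "A \<in> carrier ?G" for A
    using cm[OF that] by (simp add: mult one)
  show "A \<otimes>\<^bsub>?G\<^esub> B \<in> carrier ?G" if AB: "A \<in> carrier ?G" "B \<in> carrier ?G" for A B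
  proof -
    obtain \<pi> c where c: "Gmpn_data m p n \<pi> c" and A: "A = monomial_mat n \<pi> c"
      using Gmpn_obtain_data[OF AB(1)] .
    obtain \<rho> d where d: "Gmpn_data m p n \<rho> d" and B: "B = monomial_mat n \<rho> d"
      using Gmpn_obtain_data[OF AB(2)] .
    have \<pi>: "\<pi> permutes {..<n}" using c by (simp add: Gmpn_data_def)
    have "(\<Prod>i<n. d (\<pi> i)) = (\<Prod>i<n. d i)"
      using prod.permute[OF \<pi>, of d] by (simp add: o_def)
    moreover have "i < n \<Longrightarrow> \<pi> i < n" for i
      using permutes_in_image[OF \<pi>, of i] by simp
    ultimately have "Gmpn_data m p n (\<rho> \<circ> \<pi>) (\<lambda>i. c i * d (\<pi> i))"
      using c d by (auto simp: Gmpn_data_def prod.distrib power_mult_distrib intro: permutes_compose)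
    then show ?thesis
      unfolding mult A B monomial_mat_mult[OF \<pi>] by (rule I)
  qed
  show "\<exists>B \<in> carrier ?G. B \<otimes>\<^bsub>?G\<^esub> A = \<one>\<^bsub>?G\<^esub>" if A_in: "A \<in> carrier ?G" for A
  proof -
    obtain \<pi> c where c: "Gmpn_data m p n \<pi> c" and A: "A = monomial_mat n \<pi> c"
      using Gmpn_obtain_data[OF A_in] .
    define \<rho> where "\<rho> = inv_into UNIV \<pi>"
    define d where "d i = inverse (c (\<rho> i))" for i
    have \<pi>: "\<pi> permutes {..<n}" using c by (simp add: Gmpn_data_def)
    then have \<rho>: "\<rho> permutes {..<n}" unfolding \<rho>_def by (rule permutes_inv)
    have lt: "i < n \<Longrightarrow> \<rho> i < n" for i
      using permutes_in_image[OF \<rho>, of i] by simp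
    have nz: "c i \<noteq> 0" if "i < n" for i
      using c m that by (auto simp: Gmpn_data_def power_0_left)
    have "(\<Prod>i<n. d i) = inverse (\<Prod>i<n. c i)"
      using prod.permute[OF \<rho>, of c] by (simp add: o_def d_def prod_inversef[symmetric])
    then have "Gmpn_data m p n \<rho> d"
      using c \<rho> lt by (auto simp: Gmpn_data_def d_def power_inverse)
    then have "monomial_mat n \<rho> d \<in> carrier ?G" by (rule I)
    moreover have "monomial_mat n \<rho> d * A = 1\<^sub>m n"
    proof -
      have "\<pi> \<circ> \<rho> = id" unfolding \<rho>_def using permutes_inv_o(1)[OF \<pi>] .
      then have "monomial_mat n \<rho> d * A = monomial_mat n id (\<lambda>i. d i * c (\<rho> i))"
        unfolding A monomial_mat_mult[OF \<rho>] by simp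
      also have "\<dots> = monomial_mat n id (\<lambda>_. 1)"
        unfolding monomial_mat_def using nz lt by (intro cong_mat) (auto simp: d_def)
      finally show ?thesis by (simp add: monomial_mat_one)
    qed
    ultimately show ?thesis by (auto simp: mult one)
  qed
qed


subsection \<open>The action\<close>

lemma meval_superset:
  assumes "finite S" "Poly_Mapping.keys f \<subseteq> S"
  shows "meval f v =
    (\<Sum>a\<in>S. Poly_Mapping.lookup f a * (\<Prod>i\<in>Poly_Mapping.keys a. (v $ i) ^ Poly_Mapping.lookup a i))"
  unfolding meval_def using assms
  by (intro sum.mono_neutral_left) (auto simp: in_keys_iff)

lemma meval_zero: "meval 0 v = 0"
  by (simp add: meval_def)

lemma meval_add: "meval (f + g) v = meval f v + meval g v"
proof -
  let ?S = "Poly_Mapping.keys f \<union> Poly_Mapping.keys g"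
  have "meval h v = (\<Sum>a\<in>?S. Poly_Mapping.lookup h a *
      (\<Prod>i\<in>Poly_Mapping.keys a. (v $ i) ^ Poly_Mapping.lookup a i))" if "h \<in> {f, g, f + g}" for h
    using that Poly_Mapping.keys_add[of f g] by (intro meval_superset) auto
  then show ?thesis by (simp add: lookup_add algebra_simps sum.distrib)
qed

lemma meval_sum: "meval (sum f S) v = (\<Sum>x\<in>S. meval (f x) v)"
  by (induction S rule: infinite_finite_induct) (simp_all add: meval_zero meval_add)

lemma meval_single:
  "meval (Poly_Mapping.single a c) v = c * (\<Prod>i\<in>Poly_Mapping.keys a. (v $ i) ^ Poly_Mapping.lookup a i)"
  by (simp add: meval_def)

lemma monomial_value_add:
  fixes a b :: monom and v :: "complex vec"
  shows "(\<Prod>i\<in>Poly_Mapping.keys (a + b). (v $ i) ^ Poly_Mapping.lookup (a + b) i) =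
    (\<Prod>i\<in>Poly_Mapping.keys a. (v $ i) ^ Poly_Mapping.lookup a i) *
    (\<Prod>i\<in>Poly_Mapping.keys b. (v $ i) ^ Poly_Mapping.lookup b i)"
proof -
  let ?S = "Poly_Mapping.keys a \<union> Poly_Mapping.keys b"
  have S: "(\<Prod>i\<in>Poly_Mapping.keys e. (v $ i) ^ Poly_Mapping.lookup e i) =
      (\<Prod>i\<in>?S. (v $ i) ^ Poly_Mapping.lookup e i)" if "e \<in> {a, b, a + b}" for e
    using that Poly_Mapping.keys_add[of a b]
    by (intro prod.mono_neutral_left) (auto simp: in_keys_iff)
  show ?thesis
    unfolding S[of a, simplified] S[of b, simplified] S[of "a + b", simplified]
    by (simp add: lookup_add power_add prod.distrib)
qed

lemma mpoly_sum_singles: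
  fixes f :: mpoly
  shows "f = (\<Sum>a\<in>Poly_Mapping.keys f. Poly_Mapping.single a (Poly_Mapping.lookup f a))"
proof (rule poly_mapping_eqI)
  fix a
  have "(\<Sum>b\<in>Poly_Mapping.keys f. Poly_Mapping.lookup f b when b = a) =
      (if a \<in> Poly_Mapping.keys f then Poly_Mapping.lookup f a else 0)"
    by (simp add: when_def)
  then show "Poly_Mapping.lookup f a =
      Poly_Mapping.lookup (\<Sum>b\<in>Poly_Mapping.keys f. Poly_Mapping.single b (Poly_Mapping.lookup f b)) a"
    by (auto simp: lookup_sum lookup_single in_keys_iff)
qed

lemma meval_mult: "meval (f * g) v = meval f v * meval g v"
proof -
  have single: "meval (Poly_Mapping.single a c * Poly_Mapping.single b d) v =
      meval (Poly_Mapping.single a c) v * meval (Poly_Mapping.single b d) v" for a b c d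
    by (simp add: mult_single meval_single monomial_value_add)
  let ?s = "\<lambda>h a. Poly_Mapping.single a (Poly_Mapping.lookup h a) :: mpoly"
  have "f * g = (\<Sum>a\<in>Poly_Mapping.keys f. \<Sum>b\<in>Poly_Mapping.keys g. ?s f a * ?s g b)"
    using mpoly_sum_singles[of f] mpoly_sum_singles[of g] by (metis (no_types) sum_product)
  then have "meval (f * g) v =
      (\<Sum>a\<in>Poly_Mapping.keys f. \<Sum>b\<in>Poly_Mapping.keys g. meval (?s f a) v * meval (?s g b) v)"
    by (simp add: meval_sum single)
  also have "\<dots> = meval (\<Sum>a\<in>Poly_Mapping.keys f. ?s f a) v * meval (\<Sum>b\<in>Poly_Mapping.keys g. ?s g b) v"
    by (simp add: meval_sum sum_product)
  finally show ?thesis by (simp flip: mpoly_sum_singles)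
qed

lemma meval_one: "meval 1 v = 1"
  by (simp add: meval_def)

lemma meval_power: "meval (f ^ k) v = meval f v ^ k"
  by (induction k) (simp_all add: meval_one meval_mult)

lemma meval_prod: "meval (prod f S) v = (\<Prod>x\<in>S. meval (f x) v)"
  by (induction S rule: infinite_finite_induct) (simp_all add: meval_one meval_mult)

lemma meval_mconst: "meval (mconst c) v = c"
  by (simp add: mconst_def meval_single)

lemma meval_mvar: "meval (mvar i) v = v $ i"
  by (simp add: mvar_def monomial_def meval_single)

lemma meval_Gmpn_act:
  assumes "subfield K (class_ring :: complex ring)" "\<forall>z. z ^ m = 1 \<longrightarrow> z \<in> K" "m \<ge> 1"
    and A: "A \<in> carrier (Gmpn K m p n)" and f: "f \<in> mpoly_carrier K n" and v: "v \<in> carrier_vec n"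
  shows "meval (Gmpn_act K m p n A f) v = meval f ((inv\<^bsub>Gmpn K m p n\<^esub> A) *\<^sub>v v)"
proof -
  define B where "B = inv\<^bsub>Gmpn K m p n\<^esub> A"
  have "B \<in> carrier (Gmpn K m p n)"
    unfolding B_def by (rule group.inv_closed[OF group_Gmpn[OF assms(1-3)] A])
  then have B: "B \<in> carrier_mat n n" by (simp add: Gmpn_def)
  have coord: "(B *\<^sub>v v) $ i = (\<Sum>j<n. B $$ (i, j) * v $ j)" if "i < n" for i
    using that B v by (auto simp: scalar_prod_def atLeast0LessThan intro!: sum.cong)
  have "a \<in> Poly_Mapping.keys f \<Longrightarrow> i \<in> Poly_Mapping.keys a \<Longrightarrow> i < n" for a i
    using f by (auto simp: mpoly_carrier_def)
  then show ?thesis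
    unfolding Gmpn_act_def B_def[symmetric] msubst_def meval_sum meval_mult meval_prod meval_power
      meval_mconst meval_mvar
    by (auto simp: meval_def[of f] coord intro!: sum.cong prod.cong arg_cong2[of _ _ _ _ "(*)"])
qed

end

theory Submission
  imports Defs
begin

text \<open>
Write \<open>y\<^sub>i = x\<^sub>i\<^sup>m\<close> and \<open>q = m/p\<close>, let \<open>I\<close> be the ideal generated by the invariants of positive degree,
and let variables be indexed from \<open>0\<close>. The proof shows that the Artin monomials span the polynomial
ring modulo \<open>I\<close>, and that \<open>I\<close> is too small for a linear relation between them.

\<^bold>\<open>Spanning.\<close> The complete homogeneous polynomial \<open>h\<^sub>r(y\<^sub>i, \<dots>, y\<^sub>n\<^sub>-\<^sub>1)\<close> lies in \<open>I\<close> for \<open>r > i\<close>, and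
\<open>h\<^sub>i(y\<^sub>i, \<dots>, y\<^sub>n\<^sub>-\<^sub>1) \<equiv> \<plusminus> y\<^sub>0 \<cdots> y\<^sub>i\<^sub>-\<^sub>1\<close> modulo \<open>I\<close> (lemmas \<open>complete_hom_in_I\<close> and \<open>complete_hom_diagonal\<close>).
Both follow by induction on \<open>i\<close> from the case \<open>i = 0\<close>, where \<open>h\<^sub>r\<close> is symmetric in all the \<open>y\<^sub>k\<close> and
therefore invariant, by means of
\<open>h\<^sub>r\<^sub>+\<^sub>1(y\<^sub>i, \<dots>) = h\<^sub>r\<^sub>+\<^sub>1(y\<^sub>i\<^sub>+\<^sub>1, \<dots>) + y\<^sub>i h\<^sub>r(y\<^sub>i, \<dots>)\<close>. As \<open>(x\<^sub>0 \<cdots> x\<^sub>n\<^sub>-\<^sub>1)\<^sup>q\<close> is invariant and \<open>q \<le> m\<close>, the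
second congruence puts \<open>(x\<^sub>i \<cdots> x\<^sub>n\<^sub>-\<^sub>1)\<^sup>q h\<^sub>i(y\<^sub>i, \<dots>)\<close> into \<open>I\<close>. For the lexicographic order in which
\<open>x\<^sub>0\<close> is the largest variable, the resulting leading monomials are \<open>x\<^sub>i\<^bsup>(i+1)m\<^esup>\<close>,
\<open>(x\<^sub>i \<cdots> x\<^sub>n\<^sub>-\<^sub>1)\<^sup>q x\<^sub>i\<^bsup>im\<^esup>\<close> and \<open>(x\<^sub>0 \<cdots> x\<^sub>n\<^sub>-\<^sub>1)\<^sup>q\<close>, and a monomial divisible by none of them is an Artin
monomial: \<open>j\<close> is its last index with \<open>a\<^sub>j < q\<close>. Reduction gives lemma \<open>P_spanned\<close>.

\<^bold>\<open>Independence.\<close> The orbit of the point \<open>(1, 2, \<dots>, n)\<close> has \<open>n! m\<^sup>n\<^sup>-\<^sup>1 q\<close> points, at least as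
many as there are Artin exponents (lemmas \<open>card_orbit\<close> and \<open>card_artin\<close>). On the orbit every invariant is
constant, so an element of \<open>I\<close> of degree at most \<open>d\<close> agrees there with a polynomial of degree
less than \<open>d\<close> (lemma \<open>degree_drops_if_in_I\<close>). Hence, by induction on the degree, spanning modulo \<open>I\<close>
becomes spanning on the orbit: every polynomial agrees there with a combination of Artin monomials
of no larger degree (lemma \<open>artin_on_orbit\<close>). Since polynomials separate the points of the orbit,
the Artin monomials span all functions on it, and being no more numerous than its points they are
linearly independent as functions (lemma \<open>artin_independent_on_orbit\<close>). A nonzero relation
\<open>g \<in> I\<close> of degree \<open>d\<close> between Artin monomials would agree on the orbit with a combination of
Artin monomials of degree less than \<open>d\<close>, which contradicts this independence (lemma
\<open>artin_independent\<close>).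
\<close>

abbreviation lookup :: "('a \<Rightarrow>\<^sub>0 'b::zero) \<Rightarrow> 'a \<Rightarrow> 'b" where
  "lookup \<equiv> Poly_Mapping.lookup"

abbreviation keys :: "('a \<Rightarrow>\<^sub>0 'b::zero) \<Rightarrow> 'a set" where
  "keys \<equiv> Poly_Mapping.keys"

abbreviation single :: "'a \<Rightarrow> 'b \<Rightarrow> 'a \<Rightarrow>\<^sub>0 'b::zero" where
  "single \<equiv> Poly_Mapping.single"

section \<open>Exponents, degrees and truncation\<close>

definition mdeg :: "monom \<Rightarrow> nat" where
  "mdeg a = (\<Sum>i\<in>keys a. lookup a i)"

lemma mdeg_superset: "finite S \<Longrightarrow> keys a \<subseteq> S \<Longrightarrow> mdeg a = (\<Sum>i\<in>S. lookup a i)"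
  unfolding mdeg_def by (intro sum.mono_neutral_left) (auto simp: in_keys_iff)

lemma mdeg_add: "mdeg (a + b) = mdeg a + mdeg b"
proof -
  let ?S = "keys a \<union> keys b"
  have "mdeg c = (\<Sum>i\<in>?S. lookup c i)" if "c \<in> {a, b, a + b}" for c
    using that Poly_Mapping.keys_add[of a b] by (intro mdeg_superset) auto
  then show ?thesis by (simp add: lookup_add sum.distrib)
qed

lemma mdeg_single [simp]: "mdeg (single i k) = k"
  by (simp add: mdeg_def)

lemma mdeg_zero_iff: "mdeg a = 0 \<longleftrightarrow> a = 0"
  by (auto simp: mdeg_def in_keys_iff intro: poly_mapping_eqI)

lemma homogeneous_iff_mdeg: "homogeneous d f \<longleftrightarrow> (\<forall>a\<in>keys f. mdeg a = d)"
  by (simp add: homogeneous_def mdeg_def)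

lemma lookup_minus_nat: "lookup (a - b :: monom) i = lookup a i - lookup b i"
  by (simp add: lookup_minus)

lemma monom_le_add_diff:
  assumes "\<And>i. lookup b i \<le> lookup a i"
  shows "(a - b) + b = (a :: monom)"
  by (rule poly_mapping_eqI) (simp add: lookup_add lookup_minus_nat assms)

lemma keys_minus_monom: "keys (a - b :: monom) \<subseteq> keys a"
  by (auto simp: in_keys_iff lookup_minus_nat)

lemma keys_add_monom: "keys (a + b :: monom) = keys a \<union> keys b"
  by (auto simp: in_keys_iff lookup_add)

lemma keys_minus_subset: "keys (f - g :: mpoly) \<subseteq> keys f \<union> keys g"
  by (auto simp: in_keys_iff lookup_minus)

lemma keys_sum_subset: "keys (\<Sum>x\<in>S. f x) \<subseteq> (\<Union>x\<in>S. keys (f x :: 'b \<Rightarrow>\<^sub>0 'c::comm_monoid_add))"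
proof (induction S rule: infinite_finite_induct)
  case (insert x S)
  then show ?case using Poly_Mapping.keys_add[of "f x" "sum f S"] by auto
qed auto

definition trunc :: "nat \<Rightarrow> mpoly \<Rightarrow> mpoly" where
  "trunc d f = (\<Sum>a\<in>{a \<in> keys f. mdeg a \<le> d}. single a (lookup f a))"

lemma lookup_trunc: "lookup (trunc d f) a = (if mdeg a \<le> d then lookup f a else 0)"
proof -
  have "lookup (trunc d f) a = (\<Sum>b\<in>{b \<in> keys f. mdeg b \<le> d}. if b = a then lookup f b else 0)"
    by (simp add: trunc_def lookup_sum lookup_single when_def)
  also have "\<dots> = (if a \<in> keys f \<and> mdeg a \<le> d then lookup f a else 0)"
    by (subst sum.delta) auto
  finally show ?thesis by (auto simp: in_keys_iff)
qed

lemma keys_trunc: "keys (trunc d f) = {a \<in> keys f. mdeg a \<le> d}"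
  by (auto simp: in_keys_iff lookup_trunc split: if_splits)

lemma trunc_add: "trunc d (f + g) = trunc d f + trunc d g"
  by (rule poly_mapping_eqI) (simp add: lookup_trunc lookup_add)

lemma trunc_minus: "trunc d (f - g) = trunc d f - trunc d g"
  by (rule poly_mapping_eqI) (simp add: lookup_trunc lookup_minus)

lemma trunc_eq_self: "(\<And>a. a \<in> keys f \<Longrightarrow> mdeg a \<le> d) \<Longrightarrow> trunc d f = f"
  by (rule poly_mapping_eqI) (auto simp: lookup_trunc in_keys_iff)

lemma trunc_eq_zero: "(\<And>a. a \<in> keys f \<Longrightarrow> d < mdeg a) \<Longrightarrow> trunc d f = 0"
  by (rule poly_mapping_eqI) (force simp: lookup_trunc in_keys_iff)

text \<open>
Splitting \<open>g\<close> at degree \<open>d - e\<close> splits \<open>g * h\<close> at degree \<open>d\<close>, because multiplication by \<open>h\<close> raises all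
degrees by exactly \<open>e\<close>.
\<close>

lemma trunc_mult_homogeneous:
  assumes h: "homogeneous e h"
  shows "trunc d (g * h) = (if e \<le> d then trunc (d - e) g * h else 0)"
proof -
  have deg: "\<exists>b\<in>keys f. mdeg a = mdeg b + e" if "a \<in> keys (f * h)" for a and f :: mpoly
    using that Poly_Mapping.keys_mult[of f h] h by (force simp: homogeneous_iff_mdeg mdeg_add)
  show ?thesis
  proof (cases "e \<le> d")
    case True
    define hi where "hi = g - trunc (d - e) g"
    have hi: "b \<in> keys hi \<Longrightarrow> d - e < mdeg b" for b
      by (auto simp: hi_def in_keys_iff lookup_minus lookup_trunc split: if_splits)
    have "g * h = trunc (d - e) g * h + hi * h"
      by (simp add: hi_def algebra_simps)
    moreover have "trunc d (trunc (d - e) g * h) = trunc (d - e) g * h"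
      using deg True by (intro trunc_eq_self) (fastforce simp: keys_trunc)
    moreover have "trunc d (hi * h) = 0"
      using deg hi True by (intro trunc_eq_zero) fastforce
    ultimately show ?thesis using True by (simp add: trunc_add)
  next
    case False
    then have "trunc d (g * h) = 0" using deg by (intro trunc_eq_zero) fastforce
    then show ?thesis using False by simp
  qed
qed

text \<open>
Exponent vectors with prescribed ranges correspond to the functions in \<open>Pi\<^sub>E {..<n} B\<close>.
\<close>

lemma card_monom_box:
  fixes B :: "nat \<Rightarrow> nat set"
  shows "card {a :: monom. keys a \<subseteq> {..<n} \<and> (\<forall>i<n. lookup a i \<in> B i)} = (\<Prod>i<n. card (B i))"
    and "(\<And>i. i < n \<Longrightarrow> finite (B i)) \<Longrightarrow>
      finite {a :: monom. keys a \<subseteq> {..<n} \<and> (\<forall>i<n. lookup a i \<in> B i)}"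
proof -
  let ?S = "{a :: monom. keys a \<subseteq> {..<n} \<and> (\<forall>i<n. lookup a i \<in> B i)}"
  have bij: "bij_betw (\<lambda>a. restrict (lookup a) {..<n}) ?S (PiE {..<n} B)"
  proof (rule bij_betwI')
    fix a b assume "a \<in> ?S" "b \<in> ?S"
    then have out: "\<not> i < n \<Longrightarrow> lookup a i = 0 \<and> lookup b i = 0" for i
      by (auto simp: in_keys_iff)
    show "restrict (lookup a) {..<n} = restrict (lookup b) {..<n} \<longleftrightarrow> a = b"
    proof
      assume "restrict (lookup a) {..<n} = restrict (lookup b) {..<n}"
      then have "i < n \<Longrightarrow> lookup a i = lookup b i" for i
        by (metis lessThan_iff restrict_apply')
      then show "a = b" using out by (intro poly_mapping_eqI) metis
    qed simp
  next
    fix f assume f: "f \<in> PiE {..<n} B"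
    define a :: monom where "a = (\<Sum>i<n. single i (f i))"
    have a: "lookup a i = (if i < n then f i else 0)" for i
      by (simp add: a_def lookup_sum lookup_single when_def)
    show "\<exists>a\<in>?S. f = restrict (lookup a) {..<n}"
      using f by (intro bexI[of _ a]) (auto simp: a in_keys_iff PiE_def extensional_def split: if_splits)
  qed auto
  then have "card ?S = card (PiE {..<n} B)" by (rule bij_betw_same_card)
  then show "card ?S = (\<Prod>i<n. card (B i))" by (simp add: card_PiE)
  show "finite ?S" if "\<And>i. i < n \<Longrightarrow> finite (B i)"
    using bij_betw_finite[OF bij] that by (auto intro!: finite_PiE)
qed

section \<open>Monomials and substitutions\<close>

lemma monomial_add: "monomial (a + b) = monomial a * monomial b"
  by (simp add: monomial_def mult_single)

lemma monomial_zero: "monomial 0 = 1"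
  by (simp add: monomial_def)

lemma monomial_sum: "monomial (sum f S) = (\<Prod>i\<in>S. monomial (f i))"
  by (induction S rule: infinite_finite_induct) (simp_all add: monomial_zero monomial_add)

lemma mvar_power: "mvar i ^ k = monomial (single i k)"
  by (induction k) (simp_all add: mvar_def monomial_zero flip: monomial_add single_add)

lemma mconst_power: "mconst (c ^ k) = mconst c ^ k"
  by (induction k) (simp_all add: mconst_simps)

lemma mconst_prod: "mconst (prod f S) = (\<Prod>i\<in>S. mconst (f i))"
  by (induction S rule: infinite_finite_induct) (simp_all add: mconst_simps)

lemma mconst_mult_monomial: "mconst c * monomial a = single a c"
  by (simp add: mconst_def monomial_def mult_single)

lemma msubst_superset:
  assumes "finite S" "keys f \<subseteq> S"
  shows "msubst s f = (\<Sum>a\<in>S. mconst (lookup f a) * (\<Prod>i\<in>keys a. s i ^ lookup a i))"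
  unfolding msubst_def using assms
  by (intro sum.mono_neutral_left) (auto simp: in_keys_iff mconst_simps)

lemma msubst_add: "msubst s (f + g) = msubst s f + msubst s g"
proof -
  let ?S = "keys f \<union> keys g"
  have "msubst s h = (\<Sum>a\<in>?S. mconst (lookup h a) * (\<Prod>i\<in>keys a. s i ^ lookup a i))"
    if "h \<in> {f, g, f + g}" for h
    using that Poly_Mapping.keys_add[of f g] by (intro msubst_superset) auto
  then show ?thesis by (simp add: lookup_add mconst_simps algebra_simps sum.distrib)
qed

lemma msubst_sum: "msubst s (sum f S) = (\<Sum>x\<in>S. msubst s (f x))"
  by (induction S rule: infinite_finite_induct) (simp_all add: msubst_def[of s 0] msubst_add)

lemma msubst_monomial: "msubst s (monomial a) = (\<Prod>i\<in>keys a. s i ^ lookup a i)"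
  by (simp add: msubst_def monomial_def mconst_simps)

text \<open>
The exponent vector of \<open>\<Prod>i<n. x\<^bsub>\<pi> i\<^esub> ^ a\<^sub>i\<close>.
\<close>

definition relabel :: "nat \<Rightarrow> (nat \<Rightarrow> nat) \<Rightarrow> monom \<Rightarrow> monom" where
  "relabel n \<pi> a = (\<Sum>i<n. single (\<pi> i) (lookup a i))"

lemma lookup_relabel:
  assumes "\<pi> permutes {..<n}" "i < n"
  shows "lookup (relabel n \<pi> a) (\<pi> i) = lookup a i"
proof -
  have "lookup (relabel n \<pi> a) (\<pi> i) = (\<Sum>k<n. if k = i then lookup a k else 0)"
    using permutes_inj[OF assms(1)]
    by (simp add: relabel_def lookup_sum lookup_single when_def inj_eq)
  then show ?thesis using assms(2) by simp
qed

lemma keys_relabel: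
  assumes "\<pi> permutes {..<n}"
  shows "keys (relabel n \<pi> a) \<subseteq> {..<n}"
proof -
  have "keys (relabel n \<pi> a) \<subseteq> (\<Union>i<n. keys (single (\<pi> i) (lookup a i)))"
    unfolding relabel_def by (rule keys_sum_subset)
  also have "\<dots> \<subseteq> {..<n}" using permutes_in_image[OF assms] by (auto split: if_splits)
  finally show ?thesis .
qed

lemma mdeg_sum: "mdeg (sum f S) = (\<Sum>x\<in>S. mdeg (f x))"
  by (induction S rule: infinite_finite_induct) (simp_all add: mdeg_add, simp_all add: mdeg_def)

lemma mdeg_relabel: "keys a \<subseteq> {..<n} \<Longrightarrow> mdeg (relabel n \<pi> a) = mdeg a"
  by (simp add: relabel_def mdeg_sum mdeg_superset[of "{..<n}" a])

text \<open>
A monomial matrix sends each variable to a multiple of a variable, so it sends a monomial to a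
multiple of a monomial.
\<close>

lemma msubst_monomial_mat:
  assumes \<pi>: "\<pi> permutes {..<n}" and a: "keys a \<subseteq> {..<n}"
  shows "msubst (\<lambda>i. \<Sum>j<n. mconst (monomial_mat n \<pi> c $$ (i, j)) * mvar j) (monomial a) =
    mconst (\<Prod>i<n. c i ^ lookup a i) * monomial (relabel n \<pi> a)"
proof -
  let ?s = "\<lambda>i. \<Sum>j<n. mconst (monomial_mat n \<pi> c $$ (i, j)) * mvar j"
  have s: "?s i = mconst (c i) * mvar (\<pi> i)" if "i < n" for i
  proof -
    have "\<pi> i < n" using permutes_in_image[OF \<pi>, of i] that by simp
    have "?s i = (\<Sum>j<n. if j = \<pi> i then mconst (c i) * mvar j else 0)"
      using that by (intro sum.cong) (auto simp: monomial_mat_def mconst_simps)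
    then show ?thesis using \<open>\<pi> i < n\<close> by simp
  qed
  have "(\<Prod>i\<in>keys a. ?s i ^ lookup a i) = (\<Prod>i<n. ?s i ^ lookup a i)"
    using a by (intro prod.mono_neutral_left) (auto simp: in_keys_iff)
  also have "\<dots> = (\<Prod>i<n. mconst (c i ^ lookup a i) * monomial (single (\<pi> i) (lookup a i)))"
    by (intro prod.cong) (auto simp: s power_mult_distrib mconst_power mvar_power)
  also have "\<dots> = mconst (\<Prod>i<n. c i ^ lookup a i) * monomial (relabel n \<pi> a)"
    by (simp add: prod.distrib mconst_prod relabel_def monomial_sum)
  finally show ?thesis by (simp only: msubst_monomial)
qed

section \<open>Complete homogeneous polynomials in the m-th powers of the variables\<close>

text \<open>
The exponent vector of the monomial with exponents \<open>b\<close> in the powers \<open>x\<^sub>i\<^sup>m\<close>.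
\<close>

definition dilate :: "nat \<Rightarrow> monom \<Rightarrow> monom" where
  "dilate m b = Poly_Mapping.map ((*) m) b"

lemma lookup_dilate [simp]: "lookup (dilate m b) i = m * lookup b i"
  by (simp add: dilate_def Poly_Mapping.map.rep_eq when_def)

lemma keys_dilate: "keys (dilate m b) \<subseteq> keys b"
  by (auto simp: in_keys_iff)

lemma dilate_add: "dilate m (a + b) = dilate m a + dilate m b"
  by (rule poly_mapping_eqI) (simp add: lookup_add algebra_simps)

lemma dilate_single: "dilate m (single i k) = single i (m * k)"
  by (rule poly_mapping_eqI) (simp add: lookup_single when_def)

lemma mdeg_dilate: "mdeg (dilate m b) = m * mdeg b"
  using mdeg_superset[OF _ keys_dilate, of b m] by (simp add: mdeg_def sum_distrib_left)

lemma relabel_dilate: "relabel n \<pi> (dilate m b) = dilate m (relabel n \<pi> b)"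
  by (rule poly_mapping_eqI) (simp add: relabel_def lookup_sum lookup_single when_def sum_distrib_left if_distrib cong: if_cong)

definition exps_of_degree :: "nat \<Rightarrow> nat \<Rightarrow> nat \<Rightarrow> monom set" where
  "exps_of_degree n i r = {b. keys b \<subseteq> {i..<n} \<and> mdeg b = r}"

lemma lookup_le_mdeg: "lookup a i \<le> mdeg a"
proof (cases "i \<in> keys a")
  case True
  then show ?thesis unfolding mdeg_def by (intro member_le_sum) auto
qed (simp add: in_keys_iff)

lemma finite_exps_of_degree: "finite (exps_of_degree n i r)"
proof (rule finite_subset)
  show "exps_of_degree n i r \<subseteq> {a. keys a \<subseteq> {..<n} \<and> (\<forall>k<n. lookup a k \<in> {..r})}"
    using lookup_le_mdeg by (force simp: exps_of_degree_def)
qed (rule card_monom_box(2), simp)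

text \<open>
The complete homogeneous symmetric polynomial \<open>h\<^sub>r(x\<^sub>i\<^sup>m, \<dots>, x\<^sub>n\<^sub>-\<^sub>1\<^sup>m)\<close>.
\<close>

definition complete_hom :: "nat \<Rightarrow> nat \<Rightarrow> nat \<Rightarrow> nat \<Rightarrow> mpoly" where
  "complete_hom m n i r = (\<Sum>b\<in>exps_of_degree n i r. monomial (dilate m b))"

lemma exps_of_degree_0: "exps_of_degree n i 0 = {0}"
  by (auto simp: exps_of_degree_def mdeg_zero_iff)

lemma complete_hom_degree_0: "complete_hom m n i 0 = 1"
proof -
  have "dilate m 0 = 0" by (rule poly_mapping_eqI) simp
  then show ?thesis by (simp add: complete_hom_def exps_of_degree_0 monomial_zero)
qed

text \<open>
An exponent vector in the variables \<open>i, \<dots>, n - 1\<close> either does not involve variable \<open>i\<close> or has one factor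
of it to give away.
\<close>

lemma exps_of_degree_Suc:
  assumes "i < n"
  shows "exps_of_degree n i (Suc r) =
    exps_of_degree n (Suc i) (Suc r) \<union> (\<lambda>b. b + single i 1) ` exps_of_degree n i r" (is "?L = ?R \<union> ?S")
    and "exps_of_degree n (Suc i) (Suc r) \<inter> (\<lambda>b. b + single i 1) ` exps_of_degree n i r = {}"
proof -
  have "b \<in> ?R \<union> ?S" if b: "b \<in> ?L" for b
  proof (cases "lookup b i = 0")
    case True
    then have "i \<notin> keys b" by (simp add: in_keys_iff)
    moreover have "k \<in> keys b \<Longrightarrow> i \<le> k" for k using b by (auto simp: exps_of_degree_def)
    ultimately have "k \<in> keys b \<Longrightarrow> Suc i \<le> k" for k by (metis le_neq_implies_less Suc_leI)
    then show ?thesis using b by (auto simp: exps_of_degree_def)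
  next
    case False
    define c where "c = b - single i 1"
    have bc: "b = c + single i 1"
      unfolding c_def using False by (intro monom_le_add_diff[symmetric]) (auto simp: lookup_single when_def)
    have "mdeg c = r" using b unfolding bc by (simp add: exps_of_degree_def mdeg_add)
    moreover have "keys c \<subseteq> keys b" unfolding c_def by (rule keys_minus_monom)
    ultimately have "c \<in> exps_of_degree n i r" using b by (auto simp: exps_of_degree_def)
    then show ?thesis unfolding bc by auto
  qed
  moreover have "?R \<union> ?S \<subseteq> ?L"
    using assms by (auto simp: exps_of_degree_def mdeg_add keys_add_monom)
  ultimately show "?L = ?R \<union> ?S" by blast
  show "?R \<inter> ?S = {}"
    by (force simp: exps_of_degree_def keys_add_monom)
qed

lemma complete_hom_Suc:
  assumes "i < n"
  shows "complete_hom m n i (Suc r) =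
    complete_hom m n (Suc i) (Suc r) + monomial (single i m) * complete_hom m n i r"
proof -
  let ?S = "(\<lambda>b. b + single i 1) ` exps_of_degree n i r"
  have "complete_hom m n i (Suc r) =
      complete_hom m n (Suc i) (Suc r) + (\<Sum>b\<in>?S. monomial (dilate m b))"
    unfolding complete_hom_def exps_of_degree_Suc(1)[OF assms]
    by (rule sum.union_disjoint) (use finite_exps_of_degree exps_of_degree_Suc(2)[OF assms] in auto)
  also have "(\<Sum>b\<in>?S. monomial (dilate m b)) = monomial (single i m) * complete_hom m n i r"
    unfolding complete_hom_def
    by (subst sum.reindex)
       (auto simp: inj_on_def sum_distrib_left dilate_add dilate_single monomial_add mult_ac)
  finally show ?thesis .
qed

text \<open>
Permuting all the variables permutes the summands of \<open>complete_hom m n 0 r\<close>; this is its symmetry.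
\<close>

lemma relabel_exps_of_degree:
  assumes \<pi>: "\<pi> permutes {..<n}"
  shows "bij_betw (relabel n \<pi>) (exps_of_degree n 0 r) (exps_of_degree n 0 r)"
proof -
  let ?E = "exps_of_degree n 0 r"
  have inj: "inj_on (relabel n \<pi>) ?E"
  proof (rule inj_onI)
    fix a b assume ab: "a \<in> ?E" "b \<in> ?E" "relabel n \<pi> a = relabel n \<pi> b"
    show "a = b"
    proof (rule poly_mapping_eqI)
      fix i show "lookup a i = lookup b i"
      proof (cases "i < n")
        case True
        then show ?thesis using lookup_relabel[OF \<pi> True] ab(3) by metis
      next
        case False
        then have "i \<notin> keys a" "i \<notin> keys b" using ab by (auto simp: exps_of_degree_def)
        then show ?thesis by (simp add: in_keys_iff)
      qed
    qed
  qed
  have "relabel n \<pi> ` ?E \<subseteq> ?E"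
    using keys_relabel[OF \<pi>] by (auto simp: exps_of_degree_def mdeg_relabel atLeast0LessThan)
  then show ?thesis
    using inj endo_inj_surj[OF finite_exps_of_degree] by (simp add: bij_betw_def)
qed

section \<open>The coinvariant ideal\<close>

locale Gmpn_setting =
  fixes K :: "complex set" and m p n :: nat
  assumes subfield: "subfield K (class_ring :: complex ring)"
    and roots: "\<forall>z. z ^ m = 1 \<longrightarrow> z \<in> K"
    and m_pos: "m \<ge> 1" and p_pos: "p \<ge> 1" and n_pos: "n \<ge> 1" and p_dvd: "p dvd m"
begin

abbreviation P :: "mpoly set" where "P \<equiv> mpoly_carrier K n"
abbreviation I :: "mpoly set" where "I \<equiv> coinvariant_ideal K m p n"
abbreviation G :: "complex mat monoid" where "G \<equiv> Gmpn K m p n"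
abbreviation artin :: "monom set" where "artin \<equiv> artin_exponents m p n"

definition q :: nat where "q = m div p"

lemma m_eq: "m = p * q" using p_dvd by (simp add: q_def)
lemma q_pos: "q \<ge> 1" using m_eq m_pos by (cases q) auto
lemma q_le_m: "q \<le> m" by (simp add: q_def)

lemmas K_closed = subfield_closed[OF subfield]

lemma P_add: "f \<in> P \<Longrightarrow> g \<in> P \<Longrightarrow> f + g \<in> P"
  using Poly_Mapping.keys_add[of f g] by (fastforce simp: mpoly_carrier_def lookup_add K_closed)

lemma P_uminus: "f \<in> P \<Longrightarrow> - f \<in> P"
  by (auto simp: mpoly_carrier_def K_closed)

lemma P_minus: "f \<in> P \<Longrightarrow> g \<in> P \<Longrightarrow> f - g \<in> P"
  using P_add[of f "- g"] P_uminus[of g] by simp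

lemmas P_mult = mpoly_carrier_mult[OF subfield]

lemma P_single: "keys a \<subseteq> {..<n} \<Longrightarrow> c \<in> K \<Longrightarrow> single a c \<in> P"
  by (auto simp: mpoly_carrier_def lookup_single when_def K_closed)

lemma P_monomial: "keys a \<subseteq> {..<n} \<Longrightarrow> monomial a \<in> P"
  by (simp add: monomial_def P_single K_closed)

lemma P_mconst: "c \<in> K \<Longrightarrow> mconst c \<in> P"
  using P_single[of 0 c] by (simp add: mconst_def)

lemma P_0: "0 \<in> P" and P_1: "1 \<in> P"
  using P_mconst[of 0] P_mconst[of 1] K_closed by (simp_all add: mconst_simps)

lemma P_sum: "(\<And>x. x \<in> S \<Longrightarrow> f x \<in> P) \<Longrightarrow> sum f S \<in> P"
  by (induction S rule: infinite_finite_induct) (simp_all add: P_0 P_add)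

lemma P_prod: "(\<And>x. x \<in> S \<Longrightarrow> f x \<in> P) \<Longrightarrow> prod f S \<in> P"
  by (induction S rule: infinite_finite_induct) (simp_all add: P_1 P_mult)

lemma P_trunc: "f \<in> P \<Longrightarrow> trunc d f \<in> P"
  by (auto simp: mpoly_carrier_def lookup_trunc keys_trunc K_closed)

definition generators :: "mpoly set" where
  "generators = {f \<in> P. Gmpn_invariant K m p n f \<and> (\<exists>d>0. homogeneous d f)}"

lemma generatorsI:
  assumes "f \<in> P" "\<And>A. A \<in> carrier G \<Longrightarrow> Gmpn_act K m p n A f = f" "homogeneous d f" "d > 0"
  shows "f \<in> generators"
  using assms unfolding generators_def Gmpn_invariant_def by blast

lemma I_eq: "I = Idl\<^bsub>mpoly_ring K n\<^esub> generators"
  by (simp add: coinvariant_ideal_def generators_def)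

lemma ring_simps:
  "carrier (mpoly_ring K n) = P" "mult (mpoly_ring K n) = (*)" "add (mpoly_ring K n) = (+)"
  "zero (mpoly_ring K n) = 0" "one (mpoly_ring K n) = 1"
  by (simp_all add: mpoly_ring_def)

sublocale R: cring "mpoly_ring K n"
  by (rule cring_mpoly_ring[OF subfield])

sublocale I: ideal I "mpoly_ring K n"
  by (rule ideal_coinvariant_ideal[OF subfield])

lemma generators_subset: "generators \<subseteq> I"
  unfolding I_eq by (rule R.genideal_self) (auto simp: generators_def ring_simps)

lemma I_minimal: "ideal J (mpoly_ring K n) \<Longrightarrow> generators \<subseteq> J \<Longrightarrow> I \<subseteq> J"
  unfolding I_eq by (rule R.genideal_minimal)

lemma I_P: "f \<in> I \<Longrightarrow> f \<in> P"
  using I.a_subset by (auto simp: ring_simps)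

lemma I_0: "0 \<in> I" using I.zero_closed by (simp add: ring_simps)

lemma I_add: "f \<in> I \<Longrightarrow> g \<in> I \<Longrightarrow> f + g \<in> I"
  using I.a_closed by (simp add: ring_simps)

lemma I_mult: "f \<in> I \<Longrightarrow> g \<in> P \<Longrightarrow> g * f \<in> I"
  using I.I_l_closed[of f g] by (simp add: ring_simps)

lemma I_uminus: "f \<in> I \<Longrightarrow> - f \<in> I"
  using I_mult[of f "- 1"] P_uminus[OF P_1] by simp

lemma I_minus: "f \<in> I \<Longrightarrow> g \<in> I \<Longrightarrow> f - g \<in> I"
  using I_add[of f "- g"] I_uminus by simp

lemma group_G: "group G"
  by (rule group_Gmpn[OF subfield roots m_pos])

text \<open>
The acting matrix is the inverse of \<open>A\<close>, which is again a monomial matrix; \<open>\<pi>\<close> and \<open>c\<close> belong to that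
inverse.
\<close>

lemma act_monomial:
  assumes "A \<in> carrier G"
  obtains \<pi> c where "Gmpn_data m p n \<pi> c"
    "\<And>a. keys a \<subseteq> {..<n} \<Longrightarrow> Gmpn_act K m p n A (monomial a) =
      mconst (\<Prod>i<n. c i ^ lookup a i) * monomial (relabel n \<pi> a)"
proof -
  have "inv\<^bsub>G\<^esub> A \<in> carrier G" by (rule group.inv_closed[OF group_G assms])
  then obtain \<pi> c where d: "Gmpn_data m p n \<pi> c" and A: "inv\<^bsub>G\<^esub> A = monomial_mat n \<pi> c"
    by (rule Gmpn_obtain_data)
  have "\<pi> permutes {..<n}" using d by (simp add: Gmpn_data_def)
  from msubst_monomial_mat[OF this] show ?thesis
    by (intro that[OF d]) (simp add: Gmpn_act_def A)
qed

text \<open>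
Up to a permutation of the variables, which fixes it, the monomial \<open>(x\<^sub>0 \<cdots> x\<^sub>n\<^sub>-\<^sub>1)\<^sup>q\<close> is multiplied by the
\<open>q\<close>-th power of the product of the entries, which is \<open>1\<close> on the group. So it is an invariant of positive
degree, and \<open>I\<close> contains its multiples.
\<close>

lemma product_power_in_I:
  assumes "keys a \<subseteq> {..<n}" "\<And>i. i < n \<Longrightarrow> q \<le> lookup a i"
  shows "monomial a \<in> I"
proof -
  define u :: monom where "u = (\<Sum>i<n. single i q)"
  have u: "lookup u i = (if i < n then q else 0)" for i
    by (simp add: u_def lookup_sum lookup_single when_def)
  have ku: "keys u \<subseteq> {..<n}" by (auto simp: in_keys_iff u split: if_splits)
  have relabel_u: "relabel n \<pi> u = u" if \<pi>: "\<pi> permutes {..<n}" for \<pi>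
  proof (rule poly_mapping_eqI)
    fix i show "lookup (relabel n \<pi> u) i = lookup u i"
    proof (cases "i < n")
      case True
      then obtain k where "k < n" "\<pi> k = i"
        using permutes_image[OF \<pi>] by (metis imageE lessThan_iff)
      then show ?thesis using lookup_relabel[OF \<pi>, of k u] True by (simp add: u)
    next
      case False
      then have "i \<notin> keys (relabel n \<pi> u)" using keys_relabel[OF \<pi>, of u] by auto
      then show ?thesis using False by (simp add: in_keys_iff u)
    qed
  qed
  have "Gmpn_act K m p n A (monomial u) = monomial u" if A: "A \<in> carrier G" for A
  proof -
    obtain \<pi> c where d: "Gmpn_data m p n \<pi> c" and act: "\<And>a. keys a \<subseteq> {..<n} \<Longrightarrow>
        Gmpn_act K m p n A (monomial a) = mconst (\<Prod>i<n. c i ^ lookup a i) * monomial (relabel n \<pi> a)"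
      using act_monomial[OF A] by blast
    have "(\<Prod>i<n. c i ^ lookup u i) = (\<Prod>i<n. c i) ^ q"
      by (simp add: u prod_power_distrib)
    then show ?thesis using d act[OF ku] relabel_u
      by (simp add: Gmpn_data_def q_def mconst_simps)
  qed
  moreover have "homogeneous (n * q) (monomial u)"
    using mdeg_superset[OF _ ku] by (simp add: homogeneous_iff_mdeg monomial_def u)
  moreover have "n * q > 0" using n_pos q_pos by simp
  ultimately have "monomial u \<in> generators"
    using P_monomial[OF ku] by (intro generatorsI)
  then have "monomial (a - u) * monomial u \<in> I"
    using generators_subset keys_minus_monom[of a u] assms(1) by (intro I_mult P_monomial) auto
  moreover have "a - u + u = a"
    using assms by (intro monom_le_add_diff) (auto simp: u)
  ultimately show ?thesis by (simp flip: monomial_add)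
qed

lemma P_complete_hom: "complete_hom m n i r \<in> P"
  unfolding complete_hom_def
proof (intro P_sum P_monomial)
  fix b assume "b \<in> exps_of_degree n i r"
  then show "keys (dilate m b) \<subseteq> {..<n}"
    using keys_dilate[of m b] by (auto simp: exps_of_degree_def)
qed

text \<open>
The entries of the matrix enter only through their \<open>m\<close>-th powers, which are \<open>1\<close>, and permuting the
variables permutes the summands.
\<close>

lemma complete_hom_all_variables_in_I:
  assumes "r > 0"
  shows "complete_hom m n 0 r \<in> I"
proof -
  let ?h = "complete_hom m n 0 r" and ?E = "exps_of_degree n 0 r"
  have "Gmpn_act K m p n A ?h = ?h" if A: "A \<in> carrier G" for A
  proof -
    obtain \<pi> c where d: "Gmpn_data m p n \<pi> c" and act: "\<And>a. keys a \<subseteq> {..<n} \<Longrightarrow>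
        Gmpn_act K m p n A (monomial a) = mconst (\<Prod>i<n. c i ^ lookup a i) * monomial (relabel n \<pi> a)"
      using act_monomial[OF A] by blast
    have \<pi>: "\<pi> permutes {..<n}" and c: "\<And>i. i < n \<Longrightarrow> c i ^ m = 1"
      using d by (auto simp: Gmpn_data_def)
    have "Gmpn_act K m p n A ?h = (\<Sum>b\<in>?E. Gmpn_act K m p n A (monomial (dilate m b)))"
      by (simp add: complete_hom_def Gmpn_act_def msubst_sum)
    also have "\<dots> = (\<Sum>b\<in>?E. monomial (dilate m (relabel n \<pi> b)))"
    proof (rule sum.cong)
      fix b assume "b \<in> ?E"
      then have "keys (dilate m b) \<subseteq> {..<n}"
        using keys_dilate[of m b] by (auto simp: exps_of_degree_def)
      moreover have "(\<Prod>i<n. c i ^ lookup (dilate m b) i) = 1"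
        by (rule prod.neutral) (simp add: power_mult c)
      ultimately show "Gmpn_act K m p n A (monomial (dilate m b)) = monomial (dilate m (relabel n \<pi> b))"
        by (simp add: act mconst_simps relabel_dilate)
    qed simp
    also have "\<dots> = ?h"
      unfolding complete_hom_def by (rule sum.reindex_bij_betw[OF relabel_exps_of_degree[OF \<pi>]])
    finally show ?thesis .
  qed
  moreover have "homogeneous (m * r) ?h"
    unfolding homogeneous_iff_mdeg
  proof
    fix a assume "a \<in> keys ?h"
    then obtain b where "b \<in> ?E" "a = dilate m b"
      using keys_sum_subset[of "\<lambda>b. monomial (dilate m b)" ?E]
      by (auto simp: complete_hom_def monomial_def)
    then show "mdeg a = m * r" by (simp add: mdeg_dilate exps_of_degree_def)
  qed
  moreover have "m * r > 0" using m_pos assms by simp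
  ultimately have "?h \<in> generators"
    using P_complete_hom by (intro generatorsI)
  then show ?thesis using generators_subset by auto
qed

text \<open>
Dropping the variable \<open>i\<close> costs one degree, by the recursion for \<open>complete_hom\<close>: this is why the bound
on \<open>r\<close> moves with \<open>i\<close>.
\<close>

lemma complete_hom_in_I: "i \<le> n \<Longrightarrow> i < r \<Longrightarrow> complete_hom m n i r \<in> I"
proof (induction i arbitrary: r)
  case 0
  then show ?case by (simp add: complete_hom_all_variables_in_I)
next
  case (Suc i)
  obtain s where r: "r = Suc s" "i < s" using Suc.prems by (cases r) auto
  have "complete_hom m n (Suc i) r =
      complete_hom m n i r - monomial (single i m) * complete_hom m n i s"
    using complete_hom_Suc[of i n m s] Suc.prems by (simp add: r)
  moreover have "complete_hom m n i r \<in> I" "monomial (single i m) * complete_hom m n i s \<in> I"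
    using Suc r by (auto intro!: I_mult P_monomial split: if_splits)
  ultimately show ?case by (simp add: I_minus)
qed

text \<open>
In the recursion for \<open>h\<^sub>i\<^sub>+\<^sub>1(y\<^sub>i\<^sub>+\<^sub>1, \<dots>)\<close> the term \<open>h\<^sub>i\<^sub>+\<^sub>1(y\<^sub>i, \<dots>)\<close> lies in \<open>I\<close>, so that each step only
multiplies by \<open>- y\<^sub>i\<close>. These are the congruences that account for the shift by \<open>m/p\<close> in the Artin
exponents.
\<close>

lemma complete_hom_diagonal:
  "i \<le> n \<Longrightarrow> complete_hom m n i i - (- 1) ^ i * monomial (\<Sum>k<i. single k m) \<in> I"
proof (induction i)
  case 0
  then show ?case by (simp add: complete_hom_degree_0 monomial_zero I_0)
next
  case (Suc i)
  let ?y = "monomial (single i m)" and ?Y = "monomial (\<Sum>k<i. single k m)"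
  let ?h = "complete_hom m n"
  have "?h (Suc i) (Suc i) - (- 1) ^ Suc i * monomial (\<Sum>k<Suc i. single k m) =
      ?h i (Suc i) - ?y * (?h i i - (- 1) ^ i * ?Y)"
    using complete_hom_Suc[of i n m i] Suc.prems by (simp add: monomial_add algebra_simps)
  moreover have "?y * (?h i i - (- 1) ^ i * ?Y) \<in> I"
    using Suc by (intro I_mult P_monomial) auto
  moreover have "?h i (Suc i) \<in> I"
    using Suc.prems by (intro complete_hom_in_I) auto
  ultimately show ?case by (simp add: I_minus)
qed

end

section \<open>The Artin monomials span\<close>

text \<open>
The lexicographic order on exponents of the first \<open>n\<close> variables, the variable \<open>0\<close> being the largest.
\<close>

definition lex_less :: "nat \<Rightarrow> (monom \<times> monom) set" where
  "lex_less n = {(b, a). \<exists>i<n. (\<forall>k<i. lookup b k = lookup a k) \<and> lookup b i < lookup a i}"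

lemma wf_lex_less: "wf (lex_less n)"
proof (rule wf_subset)
  show "wf (inv_image (lex less_than) (\<lambda>a :: monom. map (lookup a) [0..<n]))"
    by (intro wf_inv_image wf_lex wf_less_than)
  show "lex_less n \<subseteq> inv_image (lex less_than) (\<lambda>a. map (lookup a) [0..<n])"
  proof clarify
    fix b a :: monom assume "(b, a) \<in> lex_less n"
    then obtain i where i: "i < n" "\<forall>k<i. lookup b k = lookup a k" "lookup b i < lookup a i"
      by (auto simp: lex_less_def)
    have split: "map (lookup c) [0..<n] = map (lookup c) [0..<i] @ lookup c i # map (lookup c) [Suc i..<n]"
      for c :: monom
      using i(1) upt_add_eq_append[of 0 i "n - i"] by (simp add: upt_conv_Cons)
    have eq: "map (lookup b) [0..<i] = map (lookup a) [0..<i]" using i(2) by simp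
    show "(b, a) \<in> inv_image (lex less_than) (\<lambda>a. map (lookup a) [0..<n])"
      unfolding in_inv_image split[of a] split[of b] eq
      by (rule lex_append_leftI) (use i(3) in simp)
  qed
qed

context Gmpn_setting
begin

definition spanned :: "mpoly set" where
  "spanned = {f \<in> P. \<exists>g\<in>P. keys g \<subseteq> artin \<and> f - g \<in> I}"

lemma spanned_I: "f \<in> I \<Longrightarrow> f \<in> spanned"
  using P_0 I_P by (force simp: spanned_def)

lemma spanned_add: "f \<in> spanned \<Longrightarrow> f' \<in> spanned \<Longrightarrow> f + f' \<in> spanned"
proof -
  assume "f \<in> spanned" "f' \<in> spanned"
  then obtain g g' where g: "f \<in> P" "f' \<in> P" "g \<in> P" "g' \<in> P" "keys g \<subseteq> artin" "keys g' \<subseteq> artin"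
    "f - g \<in> I" "f' - g' \<in> I" by (auto simp: spanned_def)
  have "f + f' - (g + g') \<in> I" using I_add[OF g(7,8)] by (simp add: algebra_simps)
  then show ?thesis using g Poly_Mapping.keys_add[of g g'] by (force simp: spanned_def P_add)
qed

lemma spanned_mconst:
  assumes "f \<in> spanned" "c \<in> K"
  shows "mconst c * f \<in> spanned"
proof -
  obtain g where g: "f \<in> P" "g \<in> P" "keys g \<subseteq> artin" "f - g \<in> I"
    using assms(1) by (auto simp: spanned_def)
  have "mconst c * f - mconst c * g \<in> I"
    using I_mult[OF g(4) P_mconst[OF assms(2)]] by (simp add: algebra_simps)
  moreover have "keys (mconst c * g) \<subseteq> keys g"
    using Poly_Mapping.keys_mult[of "mconst c" g] by (auto simp: mconst_def split: if_splits)
  ultimately show ?thesis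
    using g P_mult[OF P_mconst[OF assms(2)]] by (auto simp: spanned_def)
qed

lemma spanned_sum: "(\<And>x. x \<in> S \<Longrightarrow> f x \<in> spanned) \<Longrightarrow> sum f S \<in> spanned"
  using spanned_I[OF I_0] by (induction S rule: infinite_finite_induct) (simp_all add: spanned_add)

lemma spanned_minus: "f \<in> spanned \<Longrightarrow> g \<in> spanned \<Longrightarrow> f - g \<in> spanned"
proof -
  assume fg: "f \<in> spanned" "g \<in> spanned"
  have "mconst (- 1) = - 1"
    using mconst_simps(3)[of 1 "- 1"] by (simp add: mconst_simps eq_neg_iff_add_eq_0 add.commute)
  then show ?thesis
    using spanned_add[OF fg(1) spanned_mconst[OF fg(2), of "- 1"]] K_closed(2,5) by simp
qed

text \<open>
In \<open>h\<^sub>r(y\<^sub>i, \<dots>)\<close> every monomial other than \<open>y\<^sub>i\<^sup>r\<close> has a smaller exponent at \<open>i\<close> and none below \<open>i\<close>, so that a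
multiple of \<open>h\<^sub>r(y\<^sub>i, \<dots>)\<close> in \<open>I\<close> rewrites its leading monomial into smaller ones.
\<close>

lemma spanned_reduce:
  assumes i: "i < n" and u: "keys u \<subseteq> {..<n}"
    and h: "monomial u * complete_hom m n i r \<in> I"
    and smaller: "\<And>b. keys b \<subseteq> {..<n} \<Longrightarrow> (b, u + single i (m * r)) \<in> lex_less n \<Longrightarrow> monomial b \<in> spanned"
  shows "monomial (u + single i (m * r)) \<in> spanned"
proof -
  let ?E = "exps_of_degree n i r"
  have lead: "single i r \<in> ?E" using i by (auto simp: exps_of_degree_def)
  have "monomial u * complete_hom m n i r = (\<Sum>b\<in>?E. monomial (u + dilate m b))"
    by (simp add: complete_hom_def sum_distrib_left monomial_add)
  also have "\<dots> = monomial (u + single i (m * r)) + (\<Sum>b\<in>?E - {single i r}. monomial (u + dilate m b))"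
    using sum.remove[OF finite_exps_of_degree lead, of "\<lambda>b. monomial (u + dilate m b)"]
    by (simp add: dilate_single)
  finally have "monomial (u + single i (m * r)) =
      monomial u * complete_hom m n i r - (\<Sum>b\<in>?E - {single i r}. monomial (u + dilate m b))"
    by simp
  moreover have "monomial (u + dilate m b) \<in> spanned" if b: "b \<in> ?E - {single i r}" for b
  proof (rule smaller)
    have kb: "keys b \<subseteq> {i..<n}" and db: "mdeg b = r" using b by (auto simp: exps_of_degree_def)
    then show "keys (u + dilate m b) \<subseteq> {..<n}"
      using u keys_dilate[of m b] by (auto simp: keys_add_monom)
    have "lookup b i \<noteq> r"
    proof
      assume r: "lookup b i = r"
      have "b - single i r + single i r = b"
        by (rule monom_le_add_diff) (auto simp: lookup_single when_def r)
      moreover from this have "b - single i r = 0"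
        using mdeg_add[of "b - single i r" "single i r"] db by (simp add: mdeg_zero_iff)
      ultimately show False using b by simp
    qed
    then have "lookup b i < r" using lookup_le_mdeg[of b i] db by simp
    moreover have "lookup b k = 0" if "k < i" for k
    proof -
      have "k \<notin> keys b" using kb that by auto
      then show ?thesis by (simp add: in_keys_iff)
    qed
    ultimately show "(u + dilate m b, u + single i (m * r)) \<in> lex_less n"
      using i m_pos by (auto simp: lex_less_def lookup_add lookup_single when_def intro!: exI[of _ i])
  qed
  ultimately show ?thesis
    using spanned_I[OF h] by (auto intro!: spanned_minus spanned_sum)
qed

text \<open>
A monomial that is not an Artin monomial is divisible by one of the three kinds of leading monomials,
hence reducible. The cases \<open>high\<close>, \<open>all\<close> and \<open>some\<close> are these kinds: a single exponent that is too
large, the product \<open>(x\<^sub>0 \<cdots> x\<^sub>n\<^sub>-\<^sub>1)\<^sup>q\<close>, and \<open>(x\<^sub>i \<cdots> x\<^sub>n\<^sub>-\<^sub>1)\<^sup>q y\<^sub>i\<^sup>i\<close>.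
\<close>

lemma monomial_spanned: "keys a \<subseteq> {..<n} \<Longrightarrow> monomial a \<in> spanned"
proof (induction a rule: wf_induct_rule[OF wf_lex_less[of n]])
  case (1 a)
  note ka = \<open>keys a \<subseteq> {..<n}\<close>
  have reduce: "monomial a \<in> spanned"
    if i: "i < n" and le: "m * r \<le> lookup a i"
      and h: "monomial (a - single i (m * r)) * complete_hom m n i r \<in> I" for i r
  proof -
    define u where "u = a - single i (m * r)"
    have u: "u + single i (m * r) = a"
      unfolding u_def using le by (intro monom_le_add_diff) (auto simp: lookup_single when_def)
    have "keys u \<subseteq> {..<n}" using keys_minus_monom[of a "single i (m * r)"] ka by (simp add: u_def)
    from spanned_reduce[OF i this, of r, unfolded u] show ?thesis
      using h "1.IH" by (auto simp: u_def)
  qed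
  have Pu: "monomial (a - b) \<in> P" for b
    using keys_minus_monom[of a b] ka by (intro P_monomial) auto
  consider (artin) "a \<in> artin"
    | (high) i where "i < n" "(i + 1) * m \<le> lookup a i"
    | (all) "\<forall>i<n. q \<le> lookup a i"
    | (some) "a \<notin> artin" "\<forall>i<n. lookup a i < (i + 1) * m" "\<exists>i<n. lookup a i < q"
    by (meson not_le)
  then show ?case
  proof cases
    case artin
    then show ?thesis using P_monomial[OF ka] I_0
      by (auto simp: spanned_def intro!: bexI[of _ "monomial a"]) (simp add: monomial_def)
  next
    case high
    have "monomial (a - single i (m * (i + 1))) * complete_hom m n i (i + 1) \<in> I"
      using high(1) by (intro I_mult Pu complete_hom_in_I) auto
    then show ?thesis using high by (intro reduce[of i "i + 1"]) (simp_all add: mult.commute)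
  next
    case all
    then show ?thesis using ka by (intro spanned_I product_power_in_I) auto
  next
    case some
    define S where "S = {j. j < n \<and> lookup a j < q}"
    have S: "finite S" "S \<noteq> {}" using some(3) by (auto simp: S_def)
    define j where "j = Max S"
    have j: "j < n" "lookup a j < q" using Max_in[OF S] by (auto simp: j_def S_def)
    have above: "q \<le> lookup a i" if "j < i" "i < n" for i
    proof (rule ccontr)
      assume "\<not> q \<le> lookup a i"
      then have "i \<in> S" using that by (simp add: S_def)
      then show False using Max_ge[OF S(1), of i] that by (simp add: j_def)
    qed
    \<comment> \<open>with all other conditions satisfied at \<open>j\<close>, only an upper bound beyond \<open>j\<close> can fail\<close>
    have "\<exists>i. j < i \<and> i < n \<and> q + i * m \<le> lookup a i"
    proof (rule ccontr)
      assume "\<not> ?thesis"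
      then have "\<forall>i. j < i \<and> i < n \<longrightarrow> 0 \<le> int (lookup a i) - int q \<and>
          int (lookup a i) - int q < int i * int m"
        using above by (auto simp: not_le simp flip: of_nat_mult)
      then have "a \<in> artin"
        using j some(2) ka by (auto simp: artin_exponents_def q_def intro!: exI[of _ j])
      then show False using some(1) by simp
    qed
    then obtain i where i: "j < i" "i < n" "q + i * m \<le> lookup a i" by blast
    let ?u = "a - single i (m * i)" and ?y = "\<Sum>k<i. single k m :: monom"
    have y: "lookup ?y k = (if k < i then m else 0)" for k
      by (simp add: lookup_sum lookup_single when_def)
    have ky: "keys ?y \<subseteq> {..<n}" using i(2) by (auto simp: in_keys_iff y split: if_splits)
    \<comment> \<open>each exponent is at least \<open>q\<close>: below \<open>i\<close> because of \<open>y\<^sub>k = x\<^sub>k\<^sup>m\<close> and \<open>q \<le> m\<close>, from \<open>i\<close> on because \<open>j < i\<close>\<close>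
    have "monomial (?u + ?y) \<in> I"
    proof (rule product_power_in_I)
      show "keys (?u + ?y) \<subseteq> {..<n}"
        using ka ky keys_minus_monom[of a "single i (m * i)"] by (auto simp: keys_add_monom)
      show "q \<le> lookup (?u + ?y) k" if "k < n" for k
        using i(3) above[of k] that i(1) q_le_m
        by (auto simp: lookup_add lookup_minus_nat y lookup_single when_def mult.commute)
    qed
    then have "(- 1) ^ i * monomial (?u + ?y) \<in> I"
      using I_uminus by (cases "even i") auto
    moreover have "monomial ?u * (complete_hom m n i i - (- 1) ^ i * monomial ?y) \<in> I"
      using i(2) by (intro I_mult Pu complete_hom_diagonal) auto
    ultimately have "monomial ?u * (complete_hom m n i i - (- 1) ^ i * monomial ?y)
        + (- 1) ^ i * monomial (?u + ?y) \<in> I"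
      by (rule I_add[rotated])
    then have "monomial ?u * complete_hom m n i i \<in> I"
      by (simp add: monomial_add algebra_simps)
    then show ?thesis using i by (intro reduce[of i i]) (simp_all add: mult.commute)
  qed
qed

lemma P_spanned:
  assumes "f \<in> P"
  shows "f \<in> spanned"
proof -
  have "f = (\<Sum>a\<in>keys f. mconst (lookup f a) * monomial a)"
    using mpoly_sum_singles[of f] by (simp add: mconst_mult_monomial)
  also have "\<dots> \<in> spanned"
    using assms by (intro spanned_sum spanned_mconst monomial_spanned) (auto simp: mpoly_carrier_def)
  finally show ?thesis .
qed

end

section \<open>A linear algebra criterion for independence\<close>

text \<open>
Padded by zeros to square matrices, the coefficients \<open>B\<close> form a left inverse of \<open>M\<close>, hence a right
inverse as well; cancelling \<open>M\<close> on the right of the relation \<open>c\<close> shows that \<open>c\<close> vanishes.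
\<close>

lemma independent_if_spanning_and_few:
  fixes M :: "'a \<Rightarrow> 'x \<Rightarrow> 'f::field" and B :: "'x \<Rightarrow> 'a \<Rightarrow> 'f"
  assumes X: "finite X" and A: "finite A" and card: "card A \<le> card X"
    and span: "\<And>w u. w \<in> X \<Longrightarrow> u \<in> X \<Longrightarrow> (\<Sum>a\<in>A. B w a * M a u) = (if u = w then 1 else 0)"
    and zero: "\<And>u. u \<in> X \<Longrightarrow> (\<Sum>a\<in>A. c a * M a u) = 0"
    and a: "a \<in> A"
  shows "c a = 0"
proof -
  define N where "N = card X"
  obtain x where x: "bij_betw x {..<N} X"
    using ex_bij_betw_nat_finite[OF X] by (auto simp: N_def atLeast0LessThan)
  obtain e where e: "bij_betw e {..<card A} A"
    using ex_bij_betw_nat_finite[OF A] by (auto simp: atLeast0LessThan)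
  let ?L = "card A"
  define MM where "MM = mat N N (\<lambda>(i, j). if i < ?L then M (e i) (x j) else 0)"
  define BB where "BB = mat N N (\<lambda>(i, j). if j < ?L then B (x i) (e j) else 0)"
  define C where "C = mat N N (\<lambda>(i, j). if j < ?L then c (e j) else 0)"
  have cm: "MM \<in> carrier_mat N N" "BB \<in> carrier_mat N N" "C \<in> carrier_mat N N"
    by (auto simp: MM_def BB_def C_def)
  have reindex: "(\<Sum>k<N. (if k < ?L then f (e k) else 0) * (if k < ?L then g (e k) else 0)) =
      (\<Sum>a\<in>A. f a * g a)" for f g :: "'a \<Rightarrow> 'f"
  proof -
    have "(\<Sum>k<N. (if k < ?L then f (e k) else 0) * (if k < ?L then g (e k) else 0)) =
        (\<Sum>k<?L. f (e k) * g (e k))"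
      using card by (intro sum.mono_neutral_cong_right) (auto simp: N_def)
    then show ?thesis using sum.reindex_bij_betw[OF e, of "\<lambda>a. f a * g a"] by simp
  qed
  have xX: "j < N \<Longrightarrow> x j \<in> X" for j using bij_betwE[OF x] by auto
  have "BB * MM = 1\<^sub>m N"
  proof (rule eq_matI)
    fix i j assume "i < dim_row (1\<^sub>m N :: 'f mat)" "j < dim_col (1\<^sub>m N :: 'f mat)"
    then have ij: "i < N" "j < N" by auto
    then have "(BB * MM) $$ (i, j) = (\<Sum>a\<in>A. B (x i) a * M a (x j))"
      using reindex[of "B (x i)" "\<lambda>a. M a (x j)"]
      by (simp add: BB_def MM_def scalar_prod_def atLeast0LessThan)
    also have "\<dots> = (if i = j then 1 else 0)"
      using span[OF xX xX] ij bij_betw_imp_inj_on[OF x] by (auto simp: inj_on_eq_iff)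
    finally show "(BB * MM) $$ (i, j) = 1\<^sub>m N $$ (i, j)" using ij by simp
  qed (use cm in auto)
  then have inv: "MM * BB = 1\<^sub>m N" by (rule mat_mult_left_right_inverse[OF cm(2,1)])
  have "C * MM = 0\<^sub>m N N"
  proof (rule eq_matI)
    fix i j assume "i < dim_row (0\<^sub>m N N :: 'f mat)" "j < dim_col (0\<^sub>m N N :: 'f mat)"
    then have ij: "i < N" "j < N" by auto
    then have "(C * MM) $$ (i, j) = (\<Sum>a\<in>A. c a * M a (x j))"
      using reindex[of c "\<lambda>a. M a (x j)"]
      by (simp add: C_def MM_def scalar_prod_def atLeast0LessThan)
    then show "(C * MM) $$ (i, j) = 0\<^sub>m N N $$ (i, j)" using ij zero[OF xX] by simp
  qed (use cm in auto)
  then have "C * (MM * BB) = 0\<^sub>m N N"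
    using assoc_mult_mat[OF cm(3,1,2)] cm by simp
  then have "C = 0\<^sub>m N N" using inv cm by simp
  moreover obtain k where k: "k < ?L" "e k = a" using e a unfolding bij_betw_def by (metis imageE lessThan_iff)
  moreover have "k < N" using k(1) card by (simp add: N_def)
  ultimately show "c a = 0"
    by (auto simp: C_def dest!: arg_cong[where f = "\<lambda>D. D $$ (k, k)"])
qed

section \<open>A free orbit\<close>

context Gmpn_setting
begin

text \<open>
The coordinates have pairwise different nonzero absolute values. So the absolute values of the coordinates of a
point in its orbit determine the permutation, and the point then determines the roots of unity:
the orbit is free.
\<close>

definition base_point :: "complex vec" where
  "base_point = vec n (\<lambda>i. of_nat (i + 1))"

text \<open>
Parameters for the group: a permutation, the entries of the rows \<open>1, \<dots>, n - 1\<close>, and the product of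
all entries. The product ranges over the \<open>q\<close>-th roots of unity, the other entries are arbitrary
\<open>m\<close>-th roots of unity, and the entry of row \<open>0\<close> is determined by these data; this makes the
parameters easy to count.
\<close>

definition orbit_params :: "((nat \<Rightarrow> nat) \<times> (nat \<Rightarrow> complex) \<times> complex) set" where
  "orbit_params = {\<pi>. \<pi> permutes {..<n}} \<times> (PiE {1..<n} (\<lambda>_. {z. z ^ m = 1})) \<times> {z. z ^ q = 1}"

definition entries :: "(nat \<Rightarrow> complex) \<Rightarrow> complex \<Rightarrow> nat \<Rightarrow> complex" where
  "entries c s i = (if i = 0 then s / (\<Prod>k\<in>{1..<n}. c k) else c i)"

definition orbit_point :: "(nat \<Rightarrow> nat) \<times> (nat \<Rightarrow> complex) \<times> complex \<Rightarrow> complex vec" where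
  "orbit_point = (\<lambda>(\<pi>, c, s). monomial_mat n \<pi> (entries c s) *\<^sub>v base_point)"

definition orbit :: "complex vec set" where
  "orbit = orbit_point ` orbit_params"

lemma roots_nonzero: "z ^ m = 1 \<Longrightarrow> z \<noteq> (0 :: complex)"
  using m_pos by (auto simp: power_0_left)

lemma prod_entries:
  assumes "\<And>k. k \<in> {1..<n} \<Longrightarrow> c k ^ m = 1"
  shows "(\<Prod>i<n. entries c s i) = s"
proof -
  have nz: "(\<Prod>k\<in>{1..<n}. c k) \<noteq> 0" using assms roots_nonzero by (simp add: prod_zero_iff)
  have "{..<n} = insert 0 {1..<n}" using n_pos by auto
  then have "(\<Prod>i<n. entries c s i) = entries c s 0 * (\<Prod>i\<in>{1..<n}. entries c s i)" by simp
  also have "(\<Prod>i\<in>{1..<n}. entries c s i) = (\<Prod>i\<in>{1..<n}. c i)"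
    by (intro prod.cong) (auto simp: entries_def)
  finally show ?thesis using nz by (simp add: entries_def)
qed

lemma orbit_params_data:
  assumes "(\<pi>, c, s) \<in> orbit_params"
  shows "Gmpn_data m p n \<pi> (entries c s)"
proof -
  have \<pi>: "\<pi> permutes {..<n}" and c: "\<And>k. k \<in> {1..<n} \<Longrightarrow> c k ^ m = 1" and s: "s ^ q = 1"
    using assms by (auto simp: orbit_params_def)
  have "s ^ m = (s ^ q) ^ p" by (subst m_eq) (simp add: mult.commute flip: power_mult)
  then have "s ^ m = 1" by (simp add: s)
  moreover have "(\<Prod>k\<in>{1..<n}. c k) ^ m = 1"
    unfolding prod_power_distrib by (rule prod.neutral) (use c in blast)
  ultimately have "entries c s i ^ m = 1" if "i < n" for i
    using that c by (auto simp: entries_def power_divide)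
  then show ?thesis using \<pi> s prod_entries[of c s] c by (simp add: Gmpn_data_def q_def)
qed

lemma orbit_point_carrier:
  assumes "x \<in> orbit_params"
  shows "\<exists>B\<in>carrier G. orbit_point x = B *\<^sub>v base_point"
proof -
  obtain \<pi> c s where x: "x = (\<pi>, c, s)" by (metis prod_cases3)
  have "monomial_mat n \<pi> (entries c s) \<in> carrier G"
    using monomial_mat_in_Gmpn[OF subfield roots m_pos] orbit_params_data assms unfolding x by blast
  moreover have "orbit_point x = monomial_mat n \<pi> (entries c s) *\<^sub>v base_point"
    by (simp add: x orbit_point_def)
  ultimately show ?thesis by blast
qed

lemma orbit_point_nth:
  assumes "(\<pi>, c, s) \<in> orbit_params" "i < n"
  shows "orbit_point (\<pi>, c, s) $ i = entries c s i * of_nat (\<pi> i + 1)"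
proof -
  have "\<pi> permutes {..<n}" using assms(1) by (simp add: orbit_params_def)
  from permutes_in_image[OF this, of i] have "\<pi> i < n" using assms(2) by simp
  have "orbit_point (\<pi>, c, s) $ i =
      (\<Sum>j<n. (if j = \<pi> i then entries c s i else 0) * of_nat (j + 1))"
    using assms(2) unfolding orbit_point_def base_point_def monomial_mat_def
    by (simp add: scalar_prod_def atLeast0LessThan del: of_nat_Suc of_nat_add)
  also have "\<dots> = (\<Sum>j<n. if j = \<pi> i then entries c s i * of_nat (j + 1) else 0)"
    by (intro sum.cong) auto
  finally show ?thesis using \<open>\<pi> i < n\<close> by (simp only: sum.delta finite_lessThan lessThan_iff if_True)
qed

lemma norm_root_of_unity: "z ^ m = 1 \<Longrightarrow> norm (z :: complex) = 1"
proof -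
  assume "z ^ m = 1"
  then have "norm z ^ m = 1 ^ m" by (simp flip: norm_power)
  then show ?thesis by (rule power_eq_imp_eq_base) (use m_pos in auto)
qed

lemma inj_orbit_point: "inj_on orbit_point orbit_params"
proof (rule inj_onI)
  fix x x' assume xx: "x \<in> orbit_params" "x' \<in> orbit_params" "orbit_point x = orbit_point x'"
  obtain \<pi> c s \<pi>' c' s' where x: "x = (\<pi>, c, s)" "x' = (\<pi>', c', s')"
    by (metis prod_cases3)
  have d: "Gmpn_data m p n \<pi> (entries c s)" "Gmpn_data m p n \<pi>' (entries c' s')"
    using xx(1,2) unfolding x by (auto intro: orbit_params_data)
  have eq: "entries c s i * of_nat (\<pi> i + 1) = entries c' s' i * of_nat (\<pi>' i + 1)" if "i < n" for i
    using orbit_point_nth[OF _ that, of \<pi> c s] orbit_point_nth[OF _ that, of \<pi>' c' s'] xx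
    by (simp add: x)
  have \<pi>_eq: "\<pi> i = \<pi>' i" if "i < n" for i
  proof -
    have "norm (entries c s i) = 1" "norm (entries c' s' i) = 1"
      using d that by (auto simp: Gmpn_data_def norm_root_of_unity)
    then have "norm (of_nat (\<pi> i + 1) :: complex) = norm (of_nat (\<pi>' i + 1) :: complex)"
      using arg_cong[OF eq[OF that], of norm] by (simp only: norm_mult mult_1)
    then show ?thesis unfolding norm_of_nat by simp
  qed
  have "\<pi> = \<pi>'"
  proof
    fix i show "\<pi> i = \<pi>' i"
      using \<pi>_eq[of i] d by (cases "i < n") (auto simp: Gmpn_data_def permutes_not_in)
  qed
  have ent: "entries c s i = entries c' s' i" if "i < n" for i
  proof -
    have "(of_nat (\<pi> i + 1) :: complex) \<noteq> 0" by (simp only: of_nat_eq_0_iff)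
    then show ?thesis using eq[OF that] \<open>\<pi> = \<pi>'\<close> by (simp only: mult_cancel_right) simp
  qed
  have c: "c \<in> PiE {1..<n} (\<lambda>_. {z. z ^ m = 1})" "c' \<in> PiE {1..<n} (\<lambda>_. {z. z ^ m = 1})"
    using xx(1,2) unfolding x orbit_params_def by auto
  have "c = c'"
  proof (rule PiE_ext[OF c])
    fix k assume "k \<in> {1..<n}"
    then show "c k = c' k" using ent[of k] by (simp add: entries_def)
  qed
  moreover have "s = s'"
    using prod_entries[of c s] prod_entries[of c' s'] c ent by (auto simp: PiE_iff)
  ultimately show "x = x'" using \<open>\<pi> = \<pi>'\<close> by (simp add: x)
qed

lemma finite_orbit_params: "finite orbit_params"
  and card_orbit_params: "card orbit_params = fact n * (m ^ (n - 1) * q)"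
proof -
  have roots: "finite {z :: complex. z ^ k = 1}" "card {z :: complex. z ^ k = 1} = k" if "k \<ge> 1" for k
    using that card_roots_unity_eq[of k] by (auto intro: card_ge_0_finite)
  show "finite orbit_params"
    unfolding orbit_params_def
    by (intro finite_cartesian_product finite_permutations finite_PiE roots m_pos q_pos) auto
  show "card orbit_params = fact n * (m ^ (n - 1) * q)"
    unfolding orbit_params_def
    unfolding card_cartesian_product card_PiE[OF finite_atLeastLessThan] roots(2)[OF m_pos]
      roots(2)[OF q_pos] card_permutations[OF card_lessThan finite_lessThan] by simp
qed

lemma finite_orbit: "finite orbit" by (simp add: orbit_def finite_orbit_params)

lemma card_orbit: "card orbit = fact n * (m ^ (n - 1) * q)"
  by (simp add: orbit_def card_image inj_orbit_point card_orbit_params)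

lemma K_of_nat: "of_nat k \<in> K"
  by (induction k) (simp_all add: K_closed)

lemma K_power: "x \<in> K \<Longrightarrow> x ^ k \<in> K"
  by (induction k) (simp_all add: K_closed)

lemma K_prod: "(\<And>x. x \<in> S \<Longrightarrow> f x \<in> K) \<Longrightarrow> prod f S \<in> K"
  by (induction S rule: infinite_finite_induct) (simp_all add: K_closed)

lemma orbit_obtain:
  assumes "w \<in> orbit"
  obtains B where "B \<in> carrier G" "w = B *\<^sub>v base_point"
proof -
  obtain x where "x \<in> orbit_params" "w = orbit_point x" using assms unfolding orbit_def by (rule imageE)
  then show thesis using orbit_point_carrier[of x] that by blast
qed

lemma orbit_carrier_vec: "w \<in> orbit \<Longrightarrow> w \<in> carrier_vec n"
  by (erule orbit_obtain) (auto simp: Gmpn_def base_point_def intro!: mult_mat_vec_carrier)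

lemma orbit_coordinates: "w \<in> orbit \<Longrightarrow> i < n \<Longrightarrow> w $ i \<in> K"
proof -
  assume w: "w \<in> orbit" and i: "i < n"
  then obtain \<pi> c s where x: "(\<pi>, c, s) \<in> orbit_params" "w = orbit_point (\<pi>, c, s)"
    by (auto simp: orbit_def)
  have "entries c s i ^ m = 1" using orbit_params_data[OF x(1)] i by (simp add: Gmpn_data_def)
  then have "entries c s i \<in> K" using roots by simp
  then have "entries c s i * of_nat (\<pi> i + 1) \<in> K" using K_of_nat K_closed(4) by blast
  then show ?thesis using orbit_point_nth[OF x(1) i] x(2) by simp
qed

lemma base_point_coordinates: "i < n \<Longrightarrow> base_point $ i \<in> K"
  using K_of_nat[of "i + 1"] by (simp add: base_point_def)

lemma meval_in_K:
  assumes "f \<in> P" "\<And>i. i < n \<Longrightarrow> v $ i \<in> K"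
  shows "meval f v \<in> K"
  unfolding meval_def using assms
  by (intro sum_closed_in[OF subfield] K_closed(4) K_prod K_power) (auto simp: mpoly_carrier_def)

text \<open>
A point of the orbit is \<open>B v\<close> with \<open>v\<close> the base point, and \<open>f (B v)\<close> is the value at \<open>v\<close> of the action of
\<open>B\<^sup>-\<^sup>1\<close> on \<open>f\<close>.
\<close>

lemma generator_constant_on_orbit:
  assumes f: "f \<in> generators" and w: "w \<in> orbit"
  shows "meval f w = meval f base_point"
proof -
  obtain B where B: "B \<in> carrier G" "w = B *\<^sub>v base_point" using w by (rule orbit_obtain)
  let ?A = "inv\<^bsub>G\<^esub> B"
  have A: "?A \<in> carrier G" and "inv\<^bsub>G\<^esub> ?A = B"
    using group.inv_closed[OF group_G B(1)] group.inv_inv[OF group_G B(1)] by auto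
  then have "meval (Gmpn_act K m p n ?A f) base_point = meval f w"
    using f by (subst meval_Gmpn_act[OF subfield roots m_pos A])
      (auto simp: B generators_def base_point_def)
  then show ?thesis using f A by (simp add: generators_def Gmpn_invariant_def)
qed

text \<open>
Restriction to the orbit does not respect degrees. This property records what it does to elements of
\<open>I\<close>: their invariant factors become constants, so that degrees drop.
\<close>

definition degree_drops :: "nat \<Rightarrow> mpoly \<Rightarrow> bool" where
  "degree_drops d f \<longleftrightarrow> (\<exists>r\<in>P. (\<forall>a\<in>keys r. mdeg a < d) \<and> (\<forall>w\<in>orbit. meval (trunc d f) w = meval r w))"

lemma degree_drops_add: "degree_drops d f \<Longrightarrow> degree_drops d g \<Longrightarrow> degree_drops d (f + g)"
proof -
  assume "degree_drops d f" "degree_drops d g"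
  then obtain r s where "r \<in> P" "s \<in> P" "\<forall>a\<in>keys r. mdeg a < d" "\<forall>a\<in>keys s. mdeg a < d"
    "\<forall>w\<in>orbit. meval (trunc d f) w = meval r w" "\<forall>w\<in>orbit. meval (trunc d g) w = meval s w"
    by (auto simp: degree_drops_def)
  then show ?thesis
    unfolding degree_drops_def using Poly_Mapping.keys_add[of r s]
    by (intro bexI[of _ "r + s"]) (auto simp: trunc_add meval_add P_add)
qed

text \<open>
On the orbit the factor \<open>f\<close>, of positive degree, may be replaced by its constant value.
\<close>

lemma degree_drops_generator:
  assumes f: "f \<in> generators" and g: "g \<in> P"
  shows "degree_drops d (g * f)"
proof -
  obtain e where e: "e > 0" "homogeneous e f" and fP: "f \<in> P"
    using f by (auto simp: generators_def)
  show ?thesis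
  proof (cases "e \<le> d")
    case True
    let ?c = "mconst (meval f base_point)" and ?g = "trunc (d - e) g"
    have c: "meval f base_point \<in> K" by (rule meval_in_K[OF fP base_point_coordinates])
    have "keys (?c * ?g) \<subseteq> keys ?g"
      using Poly_Mapping.keys_mult[of ?c ?g] by (auto simp: mconst_def split: if_splits)
    then have "\<forall>a\<in>keys (?c * ?g). mdeg a < d"
      using e(1) True by (fastforce simp: keys_trunc)
    then show ?thesis
      unfolding degree_drops_def using True c g generator_constant_on_orbit[OF f]
      by (intro bexI[of _ "?c * ?g"])
        (auto simp: trunc_mult_homogeneous[OF e(2)] meval_mult meval_mconst P_mult P_mconst P_trunc)
  next
    case False
    then show ?thesis
      unfolding degree_drops_def using P_0
      by (intro bexI[of _ 0]) (auto simp: trunc_mult_homogeneous[OF e(2)])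
  qed
qed

text \<open>
The polynomials all of whose multiples satisfy \<open>degree_drops d\<close> form an ideal that contains the
generators of \<open>I\<close>. Quantifying over the multiples makes this an ideal, because \<open>degree_drops d\<close> itself
is not closed under multiplication.
\<close>

lemma degree_drops_if_in_I:
  assumes "f \<in> I"
  shows "degree_drops d f"
proof -
  define J where "J = {f \<in> P. \<forall>g\<in>P. degree_drops d (g * f)}"
  have neg: "\<ominus>\<^bsub>mpoly_ring K n\<^esub> f = - f" if "f \<in> P" for f
    using that P_uminus by (intro R.minus_equality) (auto simp: ring_simps)
  have "ideal J (mpoly_ring K n)"
  proof (rule idealI[OF R.ring_axioms])
    show "subgroup J (add_monoid (mpoly_ring K n))"
    proof (rule R.add.subgroupI)
      have "degree_drops d 0" using P_0 by (auto simp: degree_drops_def trunc_def intro!: bexI[of _ 0])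
      then show "J \<noteq> {}" using P_0 by (auto simp: J_def)
      show "\<ominus>\<^bsub>mpoly_ring K n\<^esub> f \<in> J" if f: "f \<in> J" for f
      proof -
        have "g * - f = (- g) * f" for g by simp
        then show ?thesis using f P_uminus neg by (auto simp: J_def simp del: mult_minus_left mult_minus_right)
      qed
    qed (auto simp: J_def ring_simps P_add distrib_left degree_drops_add)
    show "x \<otimes>\<^bsub>mpoly_ring K n\<^esub> f \<in> J" if "f \<in> J" "x \<in> carrier (mpoly_ring K n)" for f x
      using that P_mult by (auto simp: J_def ring_simps simp flip: mult.assoc)
    show "f \<otimes>\<^bsub>mpoly_ring K n\<^esub> x \<in> J" if "f \<in> J" "x \<in> carrier (mpoly_ring K n)" for f x
      using that P_mult by (auto simp: J_def ring_simps mult.commute[of f x] simp flip: mult.assoc)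
  qed
  moreover have "generators \<subseteq> J"
    using degree_drops_generator by (auto simp: J_def generators_def)
  ultimately have "f \<in> J" using I_minimal assms by blast
  then have "degree_drops d (1 * f)" using P_1 unfolding J_def by blast
  then show ?thesis by simp
qed

text \<open>
Reduce \<open>f\<close> modulo \<open>I\<close> to a combination \<open>g\<close> of Artin monomials. In degrees at most \<open>d\<close> the remainder
\<open>f - g \<in> I\<close> agrees on the orbit with a polynomial of smaller degree, to which the induction
hypothesis applies.
\<close>

lemma artin_on_orbit:
  "f \<in> P \<Longrightarrow> (\<And>a. a \<in> keys f \<Longrightarrow> mdeg a < d) \<Longrightarrow>
    \<exists>g\<in>P. keys g \<subseteq> artin \<and> (\<forall>a\<in>keys g. mdeg a < d) \<and> (\<forall>w\<in>orbit. meval f w = meval g w)"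
proof (induction d arbitrary: f)
  case 0
  then have "f = 0" by (intro poly_mapping_eqI) (auto simp: in_keys_iff)
  then show ?case using P_0 by (intro bexI[of _ 0]) simp_all
next
  case (Suc d)
  obtain g where g: "g \<in> P" "keys g \<subseteq> artin" "f - g \<in> I"
    using P_spanned[OF Suc.prems(1)] by (auto simp: spanned_def)
  obtain r where r: "r \<in> P" "\<And>a. a \<in> keys r \<Longrightarrow> mdeg a < d"
    "\<And>w. w \<in> orbit \<Longrightarrow> meval (trunc d (f - g)) w = meval r w"
    using degree_drops_if_in_I[OF g(3), of d] by (auto simp: degree_drops_def)
  obtain h where h: "h \<in> P" "keys h \<subseteq> artin" "\<forall>a\<in>keys h. mdeg a < d" "\<forall>w\<in>orbit. meval r w = meval h w"
    using Suc.IH[OF r(1,2)] by blast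
  have "trunc d f = f" using Suc.prems(2) by (intro trunc_eq_self) (simp add: less_Suc_eq_le)
  then have f: "f = trunc d (f - g) + trunc d g" by (simp add: trunc_minus)
  have "meval f w = meval (trunc d g + h) w" if "w \<in> orbit" for w
    using r(3)[OF that] h(4) that by (subst f) (simp add: meval_add)
  moreover have "keys (trunc d g + h) \<subseteq> artin" "\<forall>a\<in>keys (trunc d g + h). mdeg a < Suc d"
    using Poly_Mapping.keys_add[of "trunc d g" h] g(2) h(2,3) by (fastforce simp: keys_trunc)+
  ultimately show ?case using P_add[OF P_trunc[OF g(1)] h(1)] by blast
qed

text \<open>
For each other point of the orbit there is a linear factor that vanishes there and not at \<open>w\<close>; its
coefficients lie in \<open>K\<close> because the coordinates of the orbit do.
\<close>

lemma interpolation: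
  assumes w: "w \<in> orbit"
  shows "\<exists>f\<in>P. \<forall>u\<in>orbit. meval f u \<noteq> 0 \<longleftrightarrow> u = w"
proof -
  have "\<exists>i<n. u $ i \<noteq> w $ i" if "u \<in> orbit" "u \<noteq> w" for u
    using that(2) eq_vecI[of w u] orbit_carrier_vec[OF that(1)] orbit_carrier_vec[OF w] by auto
  then have "\<forall>u\<in>orbit - {w}. \<exists>i. i < n \<and> u $ i \<noteq> w $ i" by blast
  then obtain i where "\<forall>u\<in>orbit - {w}. i u < n \<and> u $ i u \<noteq> w $ i u"
    by (rule bchoice[THEN exE])
  then have i: "i u < n \<and> u $ i u \<noteq> w $ i u" if "u \<in> orbit" "u \<noteq> w" for u using that by blast
  define f where "f = (\<Prod>u\<in>orbit - {w}. mvar (i u) - mconst (u $ i u))"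
  have ev: "meval f v = (\<Prod>u\<in>orbit - {w}. v $ i u - u $ i u)" for v
  proof -
    have "meval (g - h) v = meval g v - meval h v" for g h
      using meval_add[of "g - h" h v] by simp
    then show ?thesis by (simp add: f_def meval_prod meval_mvar meval_mconst)
  qed
  have "f \<in> P"
    unfolding f_def mvar_def using i orbit_coordinates
    by (intro P_prod P_minus P_monomial P_mconst) auto
  moreover have "meval f w \<noteq> 0" using i finite_orbit by (force simp: ev prod_zero_iff)
  moreover have "meval f u = 0" if "u \<in> orbit" "u \<noteq> w" for u
    unfolding ev using that finite_orbit by (intro prod_zero) auto
  ultimately show ?thesis by blast
qed

end

section \<open>The Artin exponents are not too many\<close>

text \<open>
The product counts the Artin exponents whose last index with \<open>a\<^sub>j < q\<close> is \<open>j\<close>. It does not depend on \<open>j\<close>,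
and the \<open>n\<close> choices of \<open>j\<close> turn \<open>(n - 1)!\<close> into \<open>n!\<close>.
\<close>

lemma prod_artin_ranges:
  fixes m q :: nat
  assumes "j < n"
  shows "(\<Prod>i<n. if i < j then (i + 1) * m else if i = j then q else i * m) = fact (n - 1) * (m ^ (n - 1) * q)"
  using assms
proof (induction n)
  case (Suc n)
  show ?case
  proof (cases "j = n")
    case True
    have "(\<Prod>i<k. (i + 1) * m) = fact k * m ^ k" for k
      by (induction k) (simp_all add: algebra_simps)
    then show ?thesis by (simp add: True)
  next
    case False
    then have "j < n" using Suc.prems by simp
    moreover have "n = Suc (n - 1)" using calculation by simp
    then have "fact n * m ^ n = (fact (n - 1) * m ^ (n - 1)) * (n * m)"
      by (metis fact_Suc power_Suc mult.assoc mult.commute mult.left_commute of_nat_id)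
    ultimately show ?thesis using Suc.IH by (simp add: mult_ac)
  qed
qed simp

context Gmpn_setting
begin

lemma finite_artin: "finite artin"
  and card_artin: "card artin \<le> fact n * (m ^ (n - 1) * q)"
proof -
  define B where "B j i = (if i < j then {..<(i + 1) * m} else if i = j then {..<q} else {q..<q + i * m})"
    for j i :: nat
  define box where "box j = {a :: monom. keys a \<subseteq> {..<n} \<and> (\<forall>i<n. lookup a i \<in> B j i)}" for j
  have sub: "artin \<subseteq> (\<Union>j<n. box j)"
  proof
    fix a assume "a \<in> artin"
    then obtain j where ka: "keys a \<subseteq> {..<n}" and j: "j < n" "\<forall>i<j. lookup a i < (i + 1) * m"
      "lookup a j < q" "\<forall>i. j < i \<and> i < n \<longrightarrow> 0 \<le> int (lookup a i) - int q \<and>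
        int (lookup a i) - int q < int i * int m"
      by (auto simp: artin_exponents_def q_def)
    have "lookup a i \<in> B j i" if "i < n" for i
    proof (cases "j < i")
      case True
      then have "int q \<le> int (lookup a i)" "int (lookup a i) < int (q + i * m)"
        using j(4) that by force+
      then show ?thesis using True by (simp only: B_def of_nat_le_iff of_nat_less_iff) simp
    next
      case False
      then show ?thesis using j by (auto simp: B_def)
    qed
    then show "a \<in> (\<Union>j<n. box j)" using ka j(1) by (auto simp: box_def)
  qed
  have fin: "finite (box j)" for j
    unfolding box_def by (rule card_monom_box(2)) (simp add: B_def)
  then show "finite artin" using finite_subset[OF sub] by blast
  have card: "card (box j) = fact (n - 1) * (m ^ (n - 1) * q)" if "j < n" for j
  proof -
    have "card (box j) = (\<Prod>i<n. card (B j i))"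
      unfolding box_def by (rule card_monom_box(1))
    also have "\<dots> = (\<Prod>i<n. if i < j then (i + 1) * m else if i = j then q else i * m)"
      by (intro prod.cong) (auto simp: B_def)
    finally show ?thesis using prod_artin_ranges[OF that] by simp
  qed
  have "card artin \<le> card (\<Union>j<n. box j)"
    using fin by (intro card_mono sub) auto
  also have "\<dots> \<le> (\<Sum>j<n. card (box j))" by (rule card_UN_le) simp
  also have "\<dots> = n * (fact (n - 1) * (m ^ (n - 1) * q))" by (simp add: card)
  also have "\<dots> = fact n * (m ^ (n - 1) * q)"
    using n_pos fact_reduce[of n, where ?'a = nat] by simp
  finally show "card artin \<le> fact n * (m ^ (n - 1) * q)" .
qed

section \<open>The Artin monomials are independent\<close>

text \<open>
The interpolation polynomials, rewritten as combinations of Artin monomials, show that the latter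
span all functions on the orbit.
\<close>

lemma artin_independent_on_orbit:
  assumes g: "keys g \<subseteq> artin" and zero: "\<And>w. w \<in> orbit \<Longrightarrow> meval g w = 0"
  shows "g = 0"
proof -
  define M where "M a u = (\<Prod>i\<in>keys a. (u $ i) ^ lookup a i)" for a :: monom and u :: "complex vec"
  have ev: "meval f u = (\<Sum>a\<in>artin. lookup f a * M a u)" if "keys f \<subseteq> artin" for f u
    unfolding M_def by (rule meval_superset[OF finite_artin that])
  have "\<exists>b. \<forall>u\<in>orbit. (\<Sum>a\<in>artin. b a * M a u) = (if u = w then 1 else 0)" if w: "w \<in> orbit" for w
  proof -
    obtain f where f: "f \<in> P" "\<forall>u\<in>orbit. meval f u \<noteq> 0 \<longleftrightarrow> u = w" using interpolation[OF w] by blast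
    obtain d where "\<forall>a\<in>keys f. mdeg a < d"
      using finite_nat_set_iff_bounded[of "mdeg ` keys f"] by auto
    then obtain h where h: "keys h \<subseteq> artin" "\<forall>u\<in>orbit. meval f u = meval h u"
      using artin_on_orbit[OF f(1), of d] by blast
    have "(\<Sum>a\<in>artin. lookup h a / meval f w * M a u) = meval f u / meval f w" if "u \<in> orbit" for u
      using ev[OF h(1), of u] h(2) that by (simp add: sum_divide_distrib)
    then show ?thesis using f(2) w
      by (intro exI[of _ "\<lambda>a. lookup h a / meval f w"]) auto
  qed
  then obtain B where B: "\<And>w u. w \<in> orbit \<Longrightarrow> u \<in> orbit \<Longrightarrow>
      (\<Sum>a\<in>artin. B w a * M a u) = (if u = w then 1 else 0)" by metis
  have "card artin \<le> card orbit" using card_artin card_orbit by simp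
  then have "lookup g a = 0" if "a \<in> artin" for a
    using independent_if_spanning_and_few[OF finite_orbit finite_artin _ B _ that, of "lookup g"]
      zero ev[OF g] by simp
  then show "g = 0" using g by (intro poly_mapping_eqI) (auto simp: in_keys_iff)
qed

text \<open>
The leading part of \<open>g\<close> cannot agree on the orbit with Artin monomials of smaller degree.
\<close>

lemma artin_independent:
  assumes g: "g \<in> I" and kg: "keys g \<subseteq> artin"
  shows "g = 0"
proof (rule ccontr)
  assume "g \<noteq> 0"
  then have ne: "keys g \<noteq> {}" by simp
  define d where "d = Max (mdeg ` keys g)"
  have le: "mdeg a \<le> d" if "a \<in> keys g" for a using that by (simp add: d_def)
  obtain a where a: "a \<in> keys g" "mdeg a = d"
  proof -
    have "d \<in> mdeg ` keys g" unfolding d_def using ne by (intro Max_in) auto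
    then show thesis using that by auto
  qed
  obtain r where r: "r \<in> P" "\<And>a. a \<in> keys r \<Longrightarrow> mdeg a < d"
    "\<And>w. w \<in> orbit \<Longrightarrow> meval (trunc d g) w = meval r w"
    using degree_drops_if_in_I[OF g, of d] by (auto simp: degree_drops_def)
  obtain h where h: "h \<in> P" "keys h \<subseteq> artin" "\<forall>a\<in>keys h. mdeg a < d" "\<forall>w\<in>orbit. meval r w = meval h w"
    using artin_on_orbit[OF r(1,2)] by blast
  have "meval (g - h) w = 0" if "w \<in> orbit" for w
    using meval_add[of "g - h" h w] r(3)[OF that] h(4) that trunc_eq_self[of g d] le by simp
  moreover have "keys (g - h) \<subseteq> artin" using keys_minus_subset[of g h] kg h(2) by blast
  ultimately have "g - h = 0" by (intro artin_independent_on_orbit)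
  then show False using a h(3) by auto
qed

section \<open>The basis of the coinvariant algebra\<close>

abbreviation V :: "(complex, mpoly set) module" where "V \<equiv> coinvariant_algebra K m p n"
abbreviation proj :: "mpoly \<Rightarrow> mpoly set" where "proj \<equiv> coinvariant_proj K m p n"

sublocale V: vectorspace "field_of K" V
  by (rule vectorspace_coinvariant_algebra[OF subfield])

lemma proj_eq_iff:
  shows "proj f = proj g \<longleftrightarrow> f - g \<in> I"
proof -
  have proj: "proj f = (\<lambda>h. h + f) ` I" for f
    by (auto simp: coinvariant_proj_def a_r_coset_def' ring_simps)
  show ?thesis
  proof
    assume "proj f = proj g"
    moreover have "f \<in> proj f" using I_0 by (force simp: proj)
    ultimately obtain h where "h \<in> I" "f = h + g" by (auto simp: proj)
    then show "f - g \<in> I" by simp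
  next
    assume d: "f - g \<in> I"
    have "h + f = (h + (f - g)) + g" "h + g = (h - (f - g)) + f" for h by simp_all
    then show "proj f = proj g"
      unfolding proj using I_add[OF _ d] I_minus[OF _ d] by (metis (no_types, lifting) image_cong image_eqI image_subsetI subset_antisym)
  qed
qed

lemma V_zero: "zero V = proj 0"
  by (auto simp: coinvariant_algebra_def Let_def FactRing_def coinvariant_proj_def a_r_coset_def' ring_simps)

lemma V_carrier: "carrier V = proj ` P"
  by (auto simp: coinvariant_algebra_def Let_def FactRing_def coinvariant_proj_def A_RCOSETS_def' ring_simps)

lemma proj_add: "f \<in> P \<Longrightarrow> g \<in> P \<Longrightarrow> proj (f + g) = proj f \<oplus>\<^bsub>V\<^esub> proj g"
  using ring_hom_add[OF I.rcos_ring_hom, of f g]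
  by (simp add: coinvariant_algebra_def Let_def coinvariant_proj_def ring_simps)

lemma proj_scale: "c \<in> K \<Longrightarrow> f \<in> P \<Longrightarrow> proj (mconst c * f) = c \<odot>\<^bsub>V\<^esub> proj f"
  using ring_hom_mult[OF I.rcos_ring_hom, of "mconst c" f] P_mconst[of c]
  by (simp add: coinvariant_algebra_def Let_def coinvariant_proj_def ring_simps)

lemma artin_P: "a \<in> artin \<Longrightarrow> monomial a \<in> P"
  by (intro P_monomial) (auto simp: artin_exponents_def)

lemma inj_on_proj: "inj_on (\<lambda>a. proj (monomial a)) artin"
proof (rule inj_onI)
  fix a b assume ab: "a \<in> artin" "b \<in> artin" "proj (monomial a) = proj (monomial b)"
  have "monomial a - monomial b = 0"
  proof (rule artin_independent)
    show "monomial a - monomial b \<in> I" using ab(3) by (simp add: proj_eq_iff)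
    show "keys (monomial a - monomial b) \<subseteq> artin"
      using keys_minus_subset[of "monomial a" "monomial b"] ab by (auto simp: monomial_def)
  qed
  then have "keys (monomial a) = keys (monomial b)" by simp
  then show "a = b" by (simp add: monomial_def)
qed

text \<open>
Linear combinations of classes of Artin monomials in the quotient are classes of polynomials whose
monomials are Artin monomials; this translates the statements about \<open>I\<close> into linear algebra.
\<close>

lemma lincomb_proj:
  assumes "finite S" "S \<subseteq> artin" "c \<in> (\<lambda>a. proj (monomial a)) ` S \<rightarrow> K"
  shows "V.lincomb c ((\<lambda>a. proj (monomial a)) ` S) =
    proj (\<Sum>a\<in>S. single a (c (proj (monomial a))))"
  using assms
proof (induction S)
  case empty
  then show ?case by (simp add: V.lincomb_def V_zero)
next
  case (insert a S)
  let ?p = "\<lambda>a. proj (monomial a)"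
  have new: "?p a \<notin> ?p ` S"
    using inj_on_proj insert.hyps(2) insert.prems(1) by (auto simp: inj_on_def)
  have sub: "?p ` S \<subseteq> carrier V" "?p a \<in> carrier V"
    using insert.prems(1) artin_P by (auto simp: V_carrier)
  have ca: "c (?p a) \<in> K" using insert.prems(2) by auto
  have P: "single b (c (?p b)) \<in> P" if "b \<in> insert a S" for b
    using that insert.prems by (intro P_single) (auto simp: artin_exponents_def)
  have "V.lincomb c (?p ` insert a S) = V.lincomb c (?p ` S \<union> {?p a})" by simp
  also have "\<dots> = c (?p a) \<odot>\<^bsub>V\<^esub> ?p a \<oplus>\<^bsub>V\<^esub> V.lincomb c (?p ` S)"
    using insert by (intro V.lincomb_insert sub new) auto
  also have "V.lincomb c (?p ` S) = proj (\<Sum>a\<in>S. single a (c (?p a)))"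
    using insert by auto
  also have "c (?p a) \<odot>\<^bsub>V\<^esub> ?p a = proj (single a (c (?p a)))"
    using proj_scale[OF ca artin_P, of a] insert.prems(1) by (simp add: mconst_mult_monomial)
  also have "proj (single a (c (?p a))) \<oplus>\<^bsub>V\<^esub> proj (\<Sum>a\<in>S. single a (c (?p a))) =
      proj (single a (c (?p a)) + (\<Sum>a\<in>S. single a (c (?p a))))"
    using P by (intro proj_add[symmetric] P_sum) auto
  finally show ?case using insert.hyps by simp
qed

lemma artin_basis_is_basis: "V.basis (proj ` artin_basis m p n)"
proof -
  let ?p = "\<lambda>a. proj (monomial a)"
  have image: "proj ` artin_basis m p n = ?p ` artin"
    by (simp add: artin_basis_def image_image)
  have sub: "?p ` artin \<subseteq> carrier V" using artin_P by (auto simp: V_carrier)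
  have "V.lin_indpt (?p ` artin)"
  proof (rule V.finite_lin_indpt2[OF _ sub])
    show "finite (?p ` artin)" using finite_artin by simp
    fix c assume c: "c \<in> ?p ` artin \<rightarrow> carrier (field_of K)" and "V.lincomb c (?p ` artin) = \<zero>\<^bsub>V\<^esub>"
    let ?g = "\<Sum>a\<in>artin. single a (c (?p a))"
    have "proj ?g = proj 0"
      using lincomb_proj[OF finite_artin order_refl, of c] c \<open>V.lincomb c _ = _\<close> by (simp add: V_zero)
    then have "?g \<in> I" by (simp add: proj_eq_iff)
    moreover have "keys ?g \<subseteq> artin"
      using keys_sum_subset[of "\<lambda>a. single a (c (?p a))" artin] by (auto split: if_splits)
    ultimately have "?g = 0" by (rule artin_independent)
    moreover have "lookup ?g a = c (?p a)" if "a \<in> artin" for a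
      using that finite_artin by (simp add: lookup_sum lookup_single when_def)
    ultimately show "\<forall>v\<in>?p ` artin. c v = \<zero>\<^bsub>field_of K\<^esub>" by (simp add: class_ring_simps)
  qed
  moreover have "V.span (?p ` artin) = carrier V"
  proof
    show "V.span (?p ` artin) \<subseteq> carrier V" by (rule V.span_is_subset2[OF sub])
    show "carrier V \<subseteq> V.span (?p ` artin)"
    proof
      fix Y assume "Y \<in> carrier V"
      then obtain f where f: "f \<in> P" "Y = proj f" by (auto simp: V_carrier)
      then obtain g where g: "g \<in> P" "keys g \<subseteq> artin" "f - g \<in> I"
        using P_spanned[of f] by (auto simp: spanned_def)
      define c where "c Z = lookup g (the_inv_into artin ?p Z)" for Z
      have c: "c (?p a) = lookup g a" if "a \<in> artin" for a
        using that by (simp add: c_def the_inv_into_f_f[OF inj_on_proj])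
      have cK: "c \<in> ?p ` artin \<rightarrow> K" using g(1) by (auto simp: c_def mpoly_carrier_def)
      have "g = (\<Sum>a\<in>artin. single a (lookup g a))"
        using g(2) finite_artin
        by (intro poly_mapping_eqI) (auto simp: lookup_sum lookup_single when_def in_keys_iff)
      also have "\<dots> = (\<Sum>a\<in>artin. single a (c (?p a)))" by (simp add: c)
      finally have "Y = V.lincomb c (?p ` artin)"
        using lincomb_proj[OF finite_artin order_refl cK] f(2) g(3) by (simp add: proj_eq_iff)
      then show "Y \<in> V.span (?p ` artin)"
        unfolding V.span_def using cK finite_artin by auto
    qed
  qed
  ultimately show ?thesis using sub unfolding image V.basis_def by blast
qed

end

theorem theorem5p5:
  fixes K :: "complex set" and m p n :: nat
  assumes "subfield K (class_ring :: complex ring)"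
    and "\<forall>z \<in> K. cnj z \<in> K"
    and "\<forall>z. z ^ m = 1 \<longrightarrow> z \<in> K"
    and "m \<ge> 1" and "p \<ge> 1" and "n \<ge> 1" and "p dvd m"
  shows "inj_on (coinvariant_proj K m p n) (artin_basis m p n) \<and>
         vectorspace.basis (field_of K) (coinvariant_algebra K m p n)
           (coinvariant_proj K m p n ` artin_basis m p n)"
proof -
  interpret Gmpn_setting K m p n
    by (rule Gmpn_setting.intro[OF assms(1,3-7)])
  have "inj_on (coinvariant_proj K m p n) (artin_basis m p n)"
    using inj_on_proj by (auto simp: artin_basis_def inj_on_def)
  then show ?thesis using artin_basis_is_basis by simp
qed

end
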